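(* Let $f_0\colon\mathbb R^n\to\mathbb R$ and $F\colon\mathbb R^n\to\mathbb R^m$ be twice continuously differentiable, let $g\colon\mathbb R^m\to\overline{\mathbb R}$ be proper, lower semicontinuous and convex, set $f(x,u):=f_0(x)+g(F(x)+u)$, and let $\bar x\in\mathbb R^n$ satisfy $0\in\partial_xf(\bar x,0)$. With $M$, $Y$, $\widehat Y(\bar x)$ as defined in the context, consider the following statements. (a) The mapping $M$ is isolatedly calm at $((0,0),\bar x)$. (b) Each multiplier in $\widehat Y(\bar x)$ is noncritical for $\bar x$, and $Y$ is inner calm* in the fuzzy sense w.r.t. $\operatorname{dom}Y$ at $(0,0,\bar x)$ in each direction $(0,0,d^x)$ with $d^x\neq0$. Then (a) always implies (b), while (b) implies (a) if the following qualification condition holds: $$F'(\bar x)^\top y=0,\ y\in\partial^\infty g(F(\bar x))\quad\Longrightarrow\quad y=0.$$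
   Context: Subdifferentials. For proper lower semicontinuous $h\colon\mathbb R^k\to\overline{\mathbb R}$ and $z\in\operatorname{dom}h$, $\partial h(z):=\{\zeta\mid(\zeta,-1)\in N_{\operatorname{epi}h}(z,h(z))\}$ and $\partial^\infty h(z):=\{\zeta\mid(\zeta,0)\in N_{\operatorname{epi}h}(z,h(z))\}$ are the limiting and singular subdifferential ($N$ is the limiting normal cone); subdifferentials are empty outside $\operatorname{dom}h$. $\partial_xf(x,u)$ is the limiting subdifferential of $f(\cdot,u)$ at $x$. Mappings. $M(v,u):=\{x\mid v\in\partial_xf(x,u)\}$, $Y(v,u,x):=\{y\mid(v,y)\in\partial f(x,u)\}$ for $v\in\mathbb R^n,u\in\mathbb R^m,x\in\mathbb R^n$, and $\widehat Y(\bar x):=Y(0,0,\bar x)$. With the Lagrangian $L(x,y):=f_0(x)+y^\top F(x)$, $(v,y)\in\partial f(x,u)$ amounts to $\nabla_xL(x,y)=v$, $y\in\partial g(F(x)+u)$. For a set-valued mapping $\Upsilon$, $\operatorname{dom}\Upsilon=\{x\mid\Upsilon(x)\ne\emptyset\}$, $\operatorname{gph}\Upsilon=\{(x,y)\mid y\in\Upsilon(x)\}$. Tangent cone and graphical derivative. $T_C(z):=\{d\mid\exists d_k\to d,\,t_k\downarrow0\colon z+t_kd_k\in C\ \forall k\}$ for $z\in C$; the graphical derivative $D\Upsilon(\bar a,\bar b)$ of $\Upsilon$ at $(\bar a,\bar b)\in\operatorname{gph}\Upsilon$ is the set-valued mapping with graph $T_{\operatorname{gph}\Upsilon}(\bar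 a,\bar b)$. Noncriticality. A multiplier $\bar y\in\widehat Y(\bar x)$ is noncritical for $\bar x$ if for all $d^x\in\mathbb R^n$, $d^y\in\mathbb R^m$: $\nabla^2_{xx}L(\bar x,\bar y)d^x+F'(\bar x)^\top d^y=0$ and $d^y\in D(\partial g)(F(\bar x),\bar y)(F'(\bar x)d^x)$ imply $d^x=0$. Isolated calmness. $\Upsilon\colon\mathbb R^p\rightrightarrows\mathbb R^q$ is isolatedly calm at $(\bar a,\bar b)\in\operatorname{gph}\Upsilon$ if there are $\kappa>0$ and a neighborhood $V$ of $\bar b$ with $\|b-\bar b\|\le\kappa\|a-\bar a\|$ for all $a\in\mathbb R^p$, $b\in\Upsilon(a)\cap V$. Inner calmness*. $\Upsilon\colon\mathbb R^p\rightrightarrows\mathbb R^q$ is inner calm* in the fuzzy sense w.r.t. $\operatorname{dom}\Upsilon$ at $\bar a\in\operatorname{dom}\Upsilon$ in direction $d$ if either $d\notin T_{\operatorname{dom}\Upsilon}(\bar a)$, or there are $\kappa_d>0$, $\bar b\in\mathbb R^q$ and sequences $d_k\to d$, $t_k\downarrow0$, $b_k\to\bar b$ with $\bar a+t_kd_k\in\operatorname{dom}\Upsilon$, $b_k\in\Upsilon(\bar a+t_kd_k)$, $\|b_k-\bar b\|\le\kappa_dt_k\|d_k\|$ for all $k$.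
   Formalization: Inner calmness* of Y at (0,0,x̄) does not require (0,0,x̄) to lie in dom Y; only the "either … or" condition is used, since (a) does not force a multiplier to exist and (b) would otherwise be undefined or fail. *)

theory Defs
  imports "HOL-Analysis.Analysis"
begin

definition twice_cont_differentiable ::
    "('a::real_normed_vector \<Rightarrow> 'b::real_normed_vector) \<Rightarrow> bool" where
  "twice_cont_differentiable f \<longleftrightarrow>
     (\<exists>(f' :: 'a \<Rightarrow> 'a \<Rightarrow>\<^sub>L 'b) (f'' :: 'a \<Rightarrow> 'a \<Rightarrow>\<^sub>L 'a \<Rightarrow>\<^sub>L 'b).
        (\<forall>x. (f has_derivative blinfun_apply (f' x)) (at x)) \<and>
        (\<forall>x. (f' has_derivative blinfun_apply (f'' x)) (at x)) \<and>
        continuous_on UNIV f'')"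

text \<open>Both \<open>gradient\<close> and \<open>hessian\<close> are only meaningful at points of (twice) differentiability.\<close>

definition gradient :: "('a::real_inner \<Rightarrow> real) \<Rightarrow> 'a \<Rightarrow> 'a" where
  "gradient \<phi> x = (THE D. GDERIV \<phi> x :> D)"

definition hessian :: "(real^'n \<Rightarrow> real) \<Rightarrow> real^'n \<Rightarrow> real^'n^'n" where
  "hessian \<phi> x = jacobian (gradient \<phi>) (at x)"

definition proper :: "('a \<Rightarrow> ereal) \<Rightarrow> bool" where
  "proper h \<longleftrightarrow> (\<forall>z. h z \<noteq> -\<infinity>) \<and> (\<exists>z. h z \<noteq> \<infinity>)"

definition lower_semicont :: "('a::topological_space \<Rightarrow> ereal) \<Rightarrow> bool" where
  "lower_semicont h \<longleftrightarrow> (\<forall>z. h z \<le> Liminf (at z) h)"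

definition epi :: "('a \<Rightarrow> ereal) \<Rightarrow> ('a \<times> real) set" where
  "epi h = {(z, r). h z \<le> ereal r}"

definition convex_fun :: "('a::real_vector \<Rightarrow> ereal) \<Rightarrow> bool" where
  "convex_fun h \<longleftrightarrow> convex (epi h)"

definition tangent_cone :: "'a::real_normed_vector set \<Rightarrow> 'a \<Rightarrow> 'a set" where
  "tangent_cone C z =
     {d. \<exists>(dk :: nat \<Rightarrow> 'a) (tk :: nat \<Rightarrow> real).
           dk \<longlonglongrightarrow> d \<and> (\<forall>k. 0 < tk k) \<and> tk \<longlonglongrightarrow> 0 \<and> (\<forall>k. z + tk k *\<^sub>R dk k \<in> C)}"

definition regular_normal_cone :: "'a::euclidean_space set \<Rightarrow> 'a \<Rightarrow> 'a set" where
  "regular_normal_cone C z =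
     {\<zeta>. \<forall>\<epsilon>>0. \<forall>\<^sub>F z' in at z within C. \<zeta> \<bullet> (z' - z) \<le> \<epsilon> * norm (z' - z)}"

definition limiting_normal_cone :: "'a::euclidean_space set \<Rightarrow> 'a \<Rightarrow> 'a set" where
  "limiting_normal_cone C z =
     {\<zeta>. \<exists>(zk :: nat \<Rightarrow> 'a) (\<zeta>k :: nat \<Rightarrow> 'a).
           (\<forall>k. zk k \<in> C \<and> \<zeta>k k \<in> regular_normal_cone C (zk k)) \<and> zk \<longlonglongrightarrow> z \<and> \<zeta>k \<longlonglongrightarrow> \<zeta>}"

text \<open>The guard \<open>\<bar>h z\<bar> \<noteq> \<infinity>\<close> makes both subdifferentials empty outside the domain;
  the value \<open>-\<infinity>\<close> does not occur for the functions considered.\<close>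

definition limiting_subdiff :: "('a::euclidean_space \<Rightarrow> ereal) \<Rightarrow> 'a \<Rightarrow> 'a set" where
  "limiting_subdiff h z =
     {\<zeta>. \<bar>h z\<bar> \<noteq> \<infinity> \<and> (\<zeta>, -1) \<in> limiting_normal_cone (epi h) (z, real_of_ereal (h z))}"

definition singular_subdiff :: "('a::euclidean_space \<Rightarrow> ereal) \<Rightarrow> 'a \<Rightarrow> 'a set" where
  "singular_subdiff h z =
     {\<zeta>. \<bar>h z\<bar> \<noteq> \<infinity> \<and> (\<zeta>, 0) \<in> limiting_normal_cone (epi h) (z, real_of_ereal (h z))}"

definition svm_dom :: "('a \<Rightarrow> 'b set) \<Rightarrow> 'a set" where
  "svm_dom \<Upsilon> = {a. \<Upsilon> a \<noteq> {}}"

definition svm_gph :: "('a \<Rightarrow> 'b set) \<Rightarrow> ('a \<times> 'b) set" where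
  "svm_gph \<Upsilon> = {(a, b). b \<in> \<Upsilon> a}"

definition graphical_derivative ::
    "('a::real_normed_vector \<Rightarrow> 'b::real_normed_vector set) \<Rightarrow> 'a \<Rightarrow> 'b \<Rightarrow> 'a \<Rightarrow> 'b set" where
  "graphical_derivative \<Upsilon> a b d = {e. (d, e) \<in> tangent_cone (svm_gph \<Upsilon>) (a, b)}"

definition isolatedly_calm ::
    "('a::real_normed_vector \<Rightarrow> 'b::real_normed_vector set) \<Rightarrow> 'a \<Rightarrow> 'b \<Rightarrow> bool" where
  "isolatedly_calm \<Upsilon> abar bbar \<longleftrightarrow>
     (abar, bbar) \<in> svm_gph \<Upsilon> \<and>
     (\<exists>\<kappa>>0. \<exists>V. open V \<and> bbar \<in> V \<and>
        (\<forall>a. \<forall>b \<in> \<Upsilon> a \<inter> V. norm (b - bbar) \<le> \<kappa> * norm (a - abar)))"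

text \<open>
  The reference point is not required to lie in the domain: isolated calmness of the stationarity
  mapping does not force a multiplier to exist, so for the multiplier mapping the point may lie
  outside the domain. The property then still holds in every direction not tangent to the domain.
\<close>

definition inner_calm_star_fuzzy ::
    "('a::real_normed_vector \<Rightarrow> 'b::real_normed_vector set) \<Rightarrow> 'a \<Rightarrow> 'a \<Rightarrow> bool" where
  "inner_calm_star_fuzzy \<Upsilon> abar d \<longleftrightarrow>
     d \<notin> tangent_cone (svm_dom \<Upsilon>) abar \<or>
     (\<exists>\<kappa>>0. \<exists>(bbar :: 'b) (dk :: nat \<Rightarrow> 'a) (tk :: nat \<Rightarrow> real) (bk :: nat \<Rightarrow> 'b).
        dk \<longlonglongrightarrow> d \<and> (\<forall>k. 0 < tk k) \<and> tk \<longlonglongrightarrow> 0 \<and> bk \<longlonglongrightarrow> bbar \<and>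
        (\<forall>k. abar + tk k *\<^sub>R dk k \<in> svm_dom \<Upsilon> \<and>
             bk k \<in> \<Upsilon> (abar + tk k *\<^sub>R dk k) \<and>
             norm (bk k - bbar) \<le> \<kappa> * tk k * norm (dk k)))"

definition composite ::
    "(real^'n \<Rightarrow> real) \<Rightarrow> (real^'n \<Rightarrow> real^'m) \<Rightarrow> (real^'m \<Rightarrow> ereal) \<Rightarrow> real^'n \<Rightarrow> real^'m \<Rightarrow> ereal" where
  "composite f0 F g x u = ereal (f0 x) + g (F x + u)"

definition lagrangian ::
    "(real^'n \<Rightarrow> real) \<Rightarrow> (real^'n \<Rightarrow> real^'m) \<Rightarrow> real^'n \<Rightarrow> real^'m \<Rightarrow> real" where
  "lagrangian f0 F x y = f0 x + y \<bullet> F x"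

definition stationary_map ::
    "(real^'n \<Rightarrow> real^'m \<Rightarrow> ereal) \<Rightarrow> (real^'n) \<times> (real^'m) \<Rightarrow> (real^'n) set" where
  "stationary_map f = (\<lambda>(v, u). {x. v \<in> limiting_subdiff (\<lambda>x'. f x' u) x})"

definition multiplier_map ::
    "(real^'n \<Rightarrow> real^'m \<Rightarrow> ereal) \<Rightarrow> (real^'n) \<times> (real^'m) \<times> (real^'n) \<Rightarrow> (real^'m) set" where
  "multiplier_map f = (\<lambda>(v, u, x). {y. (v, y) \<in> limiting_subdiff (\<lambda>(x', u'). f x' u') (x, u)})"

definition noncritical ::
    "(real^'n \<Rightarrow> real) \<Rightarrow> (real^'n \<Rightarrow> real^'m) \<Rightarrow> (real^'m \<Rightarrow> ereal) \<Rightarrow> real^'n \<Rightarrow> real^'m \<Rightarrow> bool" where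
  "noncritical f0 F g xbar ybar \<longleftrightarrow>
     (\<forall>(dx :: real^'n) (dy :: real^'m).
        hessian (\<lambda>x. lagrangian f0 F x ybar) xbar *v dx
          + transpose (jacobian F (at xbar)) *v dy = 0 \<and>
        dy \<in> graphical_derivative (limiting_subdiff g) (F xbar) ybar (jacobian F (at xbar) *v dx)
        \<longrightarrow> dx = 0)"

end

theory Submission
  imports Defs
begin

text \<open>
  A point of the domain of the multiplier mapping is always a point of the graph of the stationarity
  mapping, so isolated calmness forbids a tangent direction \<open>(0, 0, dx)\<close> with \<open>dx \<noteq> 0\<close> to
  that domain; a critical pair \<open>(dx, dy)\<close> would produce such a direction after perturbing \<open>u\<close>
  and \<open>v\<close> by \<open>o(t)\<close> along \<open>xbar + t dx\<close>.
  Conversely, if isolated calmness fails, there are stationary points \<open>x\<^sub>k\<close> with perturbations of size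
  \<open>o(norm (x\<^sub>k - xbar))\<close>. Under the qualification condition these points have multipliers (a fuzzy chain
  rule obtained by penalisation, plus boundedness of multipliers), so a limit direction is tangent to
  the domain of the multiplier mapping. Inner calmness* then supplies multipliers whose difference
  quotients are bounded, and passing to the limit in them contradicts noncriticality.
\<close>

section \<open>Normal cones of convex sets and of smooth preimages\<close>

text \<open>The parameter \<open>u\<close> enters additively, so the map sending
  \<open>(x, u)\<close> to \<open>F x + u\<close> is a submersion. Normals of the joint epigraph can
  therefore be computed exactly, and \<open>multiplier_map\<close> has an explicit description. With
  \<open>u\<close> frozen this surjectivity is lost: a subgradient in \<open>x\<close> need not come
  from a subgradient of \<open>g\<close>, and closing that gap is where the qualification condition
  enters. Two obstacles shape that part. Limiting normals are limits of regular normals at nearby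
  points, so only approximate multipliers at approximate points can be expected. Moreover the
  condition is posed at \<open>F xbar\<close> alone, while multipliers are wanted at all nearby
  stationary points; it is therefore converted into a norm bound on a whole neighbourhood, under
  which approximate multipliers accumulate at exact ones. Subgradient inequalities are stated for
  real numbers above the function value, that is for points of the epigraph, which keeps subtraction
  out of the extended reals.\<close>

lemma has_derivative_quotient_tendsto:
  fixes \<phi> :: "'a::real_normed_vector \<Rightarrow> 'b::real_normed_vector"
  assumes der: "(\<phi> has_derivative \<phi>') (at x)"
    and d: "d \<longlonglongrightarrow> d0" and t: "\<And>k. 0 < t k" "t \<longlonglongrightarrow> 0"
  shows "(\<lambda>k. (\<phi> (x + t k *\<^sub>R d k) - \<phi> x) /\<^sub>R t k) \<longlonglongrightarrow> \<phi>' d0"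
proof -
  have bl: "bounded_linear \<phi>'" using der by (rule has_derivative_bounded_linear)
  then interpret bounded_linear \<phi>' .
  define q where "q = (\<lambda>y. norm (\<phi> y - \<phi> x - \<phi>' (y - x)) / norm (y - x))"
  \<comment> \<open>The junk value \<open>0 / 0 = 0\<close> makes \<open>q\<close> continuous at \<open>x\<close>.\<close>
  have "q \<midarrow>x\<rightarrow> q x"
    using der unfolding has_derivative_iff_norm by (simp add: q_def)
  then have "isCont q x" by (simp add: isCont_def)
  moreover have "(\<lambda>k. x + t k *\<^sub>R d k) \<longlonglongrightarrow> x + 0 *\<^sub>R d0"
    by (intro tendsto_intros t d)
  ultimately have "(\<lambda>k. q (x + t k *\<^sub>R d k)) \<longlonglongrightarrow> q x"
    by (intro isCont_tendsto_compose[of x q]) auto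
  \<comment> \<open>The convergent factor \<open>norm (d k)\<close> is what allows the direction to
    vary with \<open>k\<close>, as it does in tangent cones.\<close>
  then have "(\<lambda>k. q (x + t k *\<^sub>R d k) * norm (d k)) \<longlonglongrightarrow> q x * norm d0"
    by (intro tendsto_intros d)
  moreover have "q (x + t k *\<^sub>R d k) * norm (d k)
      = norm ((\<phi> (x + t k *\<^sub>R d k) - \<phi> x) /\<^sub>R t k - \<phi>' (d k))" for k
  proof -
    have "(\<phi> (x + t k *\<^sub>R d k) - \<phi> x) /\<^sub>R t k - \<phi>' (d k)
        = (\<phi> (x + t k *\<^sub>R d k) - \<phi> x - \<phi>' (t k *\<^sub>R d k)) /\<^sub>R t k"
      using t(1)[of k] by (simp add: scale scaleR_diff_right)
    then show ?thesis
      using t(1)[of k] by (cases "d k = 0") (simp_all add: q_def zero divide_inverse)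
  qed
  ultimately have "(\<lambda>k. norm ((\<phi> (x + t k *\<^sub>R d k) - \<phi> x) /\<^sub>R t k - \<phi>' (d k))) \<longlonglongrightarrow> 0"
    by (simp add: q_def zero)
  then have "(\<lambda>k. (\<phi> (x + t k *\<^sub>R d k) - \<phi> x) /\<^sub>R t k - \<phi>' (d k)) \<longlonglongrightarrow> 0"
    by (rule tendsto_norm_zero_cancel)
  from tendsto_add[OF this tendsto[OF d]] show ?thesis by simp
qed

lemma real_le_zero_epsilon:
  fixes a b :: real
  assumes "\<And>\<epsilon>. \<epsilon> > 0 \<Longrightarrow> a \<le> \<epsilon> * b" "0 \<le> b"
  shows "a \<le> 0"
proof (rule field_le_epsilon)
  fix e :: real assume "e > 0"
  \<comment> \<open>The shift to \<open>b + 1\<close> covers the case \<open>b = 0\<close>.\<close>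
  then have "a \<le> e / (b + 1) * b" using assms(2) by (intro assms(1)) auto
  also have "\<dots> \<le> e" using \<open>e > 0\<close> assms(2) by (simp add: field_simps)
  finally show "a \<le> 0 + e" by simp
qed

text \<open>The function minimised is \<open>\<theta>\<close> plus \<open>e\<close> times the
  distance to \<open>x\<close>, which is not differentiable at \<open>x\<close>; one-sided quotients
  along \<open>h\<close> turn the distance term into the slack \<open>e * norm h\<close>.\<close>

lemma derivative_ge_of_sharp_minimum:
  fixes \<theta> :: "'a::real_normed_vector \<Rightarrow> real"
  assumes der: "(\<theta> has_derivative \<theta>') (at x)"
    and ev: "\<forall>\<^sub>F y in nhds x. \<theta> x \<le> \<theta> y + e * norm (y - x)"
  shows "- e * norm h \<le> \<theta>' h"
proof -
  define t where "t = (\<lambda>k. inverse (real (Suc k)))"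
  have t: "t k > 0" "t \<longlonglongrightarrow> 0" for k
    unfolding t_def using LIMSEQ_inverse_real_of_nat by auto
  have lim: "(\<lambda>k. (\<theta> (x + t k *\<^sub>R h) - \<theta> x) /\<^sub>R t k) \<longlonglongrightarrow> \<theta>' h"
    using der by (rule has_derivative_quotient_tendsto) (auto simp: t)
  have "(\<lambda>k. x + t k *\<^sub>R h) \<longlonglongrightarrow> x + 0 *\<^sub>R h" by (intro tendsto_intros t)
  then have "(\<lambda>k. x + t k *\<^sub>R h) \<longlonglongrightarrow> x" by simp
  from filterlim_iff[THEN iffD1, rule_format, OF this ev]
  have "\<forall>\<^sub>F k in sequentially. - e * norm h \<le> (\<theta> (x + t k *\<^sub>R h) - \<theta> x) /\<^sub>R t k"
  proof eventually_elim
    case (elim k)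
    have "t k * (- e * norm h) \<le> \<theta> (x + t k *\<^sub>R h) - \<theta> x"
      using elim t(1)[of k] by (simp add: algebra_simps)
    then show ?case using t(1)[of k] by (simp add: field_simps)
  qed
  then show ?thesis by (rule tendsto_lowerbound[OF lim]) simp
qed

section \<open>Tangent cones, regular normals and limiting normals\<close>

lemma tangent_coneI:
  assumes "d \<longlonglongrightarrow> d0" "\<And>k. 0 < t k" "t \<longlonglongrightarrow> 0" "\<And>k. z + t k *\<^sub>R d k \<in> C"
  shows "d0 \<in> tangent_cone C z"
  using assms unfolding tangent_cone_def by blast

text \<open>At \<open>z\<close> itself the inequality reads \<open>0 \<le> 0\<close>, so the
  punctured filter may be replaced by \<open>nhds z\<close>, which can be composed with sequences
  that hit \<open>z\<close>.\<close>

lemma regular_normal_cone_iff: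
  "\<zeta> \<in> regular_normal_cone C z \<longleftrightarrow>
    (\<forall>\<epsilon>>0. \<forall>\<^sub>F z' in nhds z. z' \<in> C \<longrightarrow> \<zeta> \<bullet> (z' - z) \<le> \<epsilon> * norm (z' - z))"
proof -
  have "(x \<noteq> z \<longrightarrow> x \<in> C \<longrightarrow> \<zeta> \<bullet> (x - z) \<le> \<epsilon> * norm (x - z)) \<longleftrightarrow>
    (x \<in> C \<longrightarrow> \<zeta> \<bullet> (x - z) \<le> \<epsilon> * norm (x - z))" for x \<epsilon>
    by (cases "x = z") simp_all
  then show ?thesis
    unfolding regular_normal_cone_def eventually_at_filter by simp
qed

text \<open>Divide the defining inequality by \<open>tk k\<close> along the tangent sequence.
  Regular normals are later tested by exhibiting suitable tangent directions.\<close>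

lemma regular_normal_tangent_le:
  assumes \<zeta>: "\<zeta> \<in> regular_normal_cone C z" and d: "d \<in> tangent_cone C z"
  shows "\<zeta> \<bullet> d \<le> 0"
proof -
  obtain dk tk where dk: "dk \<longlonglongrightarrow> d" and tk: "\<And>k. 0 < tk k" "tk \<longlonglongrightarrow> 0"
    and C: "\<And>k. z + tk k *\<^sub>R dk k \<in> C"
    using d unfolding tangent_cone_def by blast
  have "(\<lambda>k. z + tk k *\<^sub>R dk k) \<longlonglongrightarrow> z + 0 *\<^sub>R d" by (intro tendsto_intros tk dk)
  then have lim: "(\<lambda>k. z + tk k *\<^sub>R dk k) \<longlonglongrightarrow> z" by simp
  have "\<zeta> \<bullet> d \<le> \<epsilon> * norm d" if "\<epsilon> > 0" for \<epsilon>
  proof -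
    from \<zeta> that have "\<forall>\<^sub>F z' in nhds z. z' \<in> C \<longrightarrow> \<zeta> \<bullet> (z' - z) \<le> \<epsilon> * norm (z' - z)"
      unfolding regular_normal_cone_iff by blast
    from filterlim_iff[THEN iffD1, rule_format, OF lim this]
    have "\<forall>\<^sub>F k in sequentially. \<zeta> \<bullet> dk k \<le> \<epsilon> * norm (dk k)"
    proof eventually_elim
      case (elim k)
      then have "tk k * (\<zeta> \<bullet> dk k) \<le> tk k * (\<epsilon> * norm (dk k))"
        using tk(1)[of k] C[of k] by (simp add: ac_simps)
      then show ?case using tk(1)[of k] by simp
    qed
    moreover have "(\<lambda>k. \<zeta> \<bullet> dk k) \<longlonglongrightarrow> \<zeta> \<bullet> d" "(\<lambda>k. \<epsilon> * norm (dk k)) \<longlonglongrightarrow> \<epsilon> * norm d"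
      by (intro tendsto_intros dk)+
    ultimately show ?thesis by (intro tendsto_le[OF sequentially_bot]) auto
  qed
  then show ?thesis by (rule real_le_zero_epsilon[OF _ norm_ge_zero])
qed

lemma regular_normal_limiting:
  assumes "z \<in> C" "\<zeta> \<in> regular_normal_cone C z"
  shows "\<zeta> \<in> limiting_normal_cone C z"
  unfolding limiting_normal_cone_def
  using assms by (intro CollectI exI[of _ "\<lambda>_. z"] exI[of _ "\<lambda>_. \<zeta>"]) simp

text \<open>The segment from \<open>z\<close> to \<open>w\<close> makes \<open>w - z\<close>
  tangent, which turns a local inequality into a global one.\<close>

lemma regular_normal_cone_convex:
  assumes "convex C" "z \<in> C" "\<zeta> \<in> regular_normal_cone C z" "w \<in> C"
  shows "\<zeta> \<bullet> (w - z) \<le> 0"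
proof (rule regular_normal_tangent_le[OF assms(3)])
  define t where "t = (\<lambda>k. inverse (real (Suc k)))"
  show "w - z \<in> tangent_cone C z"
  proof (rule tangent_coneI)
    show "t k > 0" for k by (simp add: t_def)
    show "t \<longlonglongrightarrow> 0" unfolding t_def by (rule LIMSEQ_inverse_real_of_nat)
    have "t k \<le> 1" for k by (simp add: t_def inverse_le_1_iff)
    then show "z + t k *\<^sub>R (w - z) \<in> C" for k
      using convexD_alt[OF assms(1,2,4), of "t k"] by (simp add: t_def algebra_simps)
  qed (rule tendsto_const)
qed

text \<open>The global inequality, unlike the local one, survives limits in the base point and in
  the normal; conversely it makes a vector regular at \<open>z\<close> itself.\<close>

lemma limiting_normal_cone_convex:
  assumes "convex C" "z \<in> C"
  shows "limiting_normal_cone C z = {\<zeta>. \<forall>w\<in>C. \<zeta> \<bullet> (w - z) \<le> 0}"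
proof (intro equalityI subsetI CollectI ballI)
  fix \<zeta> w assume "\<zeta> \<in> limiting_normal_cone C z" and w: "w \<in> C"
  then obtain zk \<zeta>k where zk: "\<And>k. zk k \<in> C" "zk \<longlonglongrightarrow> z"
    and \<zeta>k: "\<And>k. \<zeta>k k \<in> regular_normal_cone C (zk k)" "\<zeta>k \<longlonglongrightarrow> \<zeta>"
    unfolding limiting_normal_cone_def by blast
  have "(\<lambda>k. \<zeta>k k \<bullet> (w - zk k)) \<longlonglongrightarrow> \<zeta> \<bullet> (w - z)"
    by (intro tendsto_intros zk \<zeta>k)
  then show "\<zeta> \<bullet> (w - z) \<le> 0"
    using regular_normal_cone_convex[OF assms(1) zk(1) \<zeta>k(1) w]
    by (intro LIMSEQ_le_const2) auto
next
  fix \<zeta> assume "\<zeta> \<in> {\<zeta>. \<forall>w\<in>C. \<zeta> \<bullet> (w - z) \<le> 0}"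
  then have *: "\<forall>w\<in>C. \<zeta> \<bullet> (w - z) \<le> 0" by blast
  have "\<zeta> \<bullet> (w - z) \<le> \<epsilon> * norm (w - z)" if "\<epsilon> > 0" "w \<in> C" for \<epsilon> w
  proof -
    have "\<zeta> \<bullet> (w - z) \<le> 0" using * that by blast
    also have "0 \<le> \<epsilon> * norm (w - z)" using that by simp
    finally show ?thesis .
  qed
  then have "\<zeta> \<in> regular_normal_cone C z"
    unfolding regular_normal_cone_iff by (auto intro!: always_eventually)
  then show "\<zeta> \<in> limiting_normal_cone C z" using assms(2) by (intro regular_normal_limiting)
qed

text \<open>For large \<open>k\<close>, a minimiser near \<open>p\<close> of
  \<open>- \<zeta> \<bullet> (x - p) + e * norm (x - p) + k * (setdist {\<Phi> x} D)\<^sup>2\<close>, which exists by compactness,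
  satisfies the first-order condition below, because the distance to \<open>D\<close> is majorised by the
  distance to the projection of its image.\<close>

lemma regular_normal_preimage_fuzzy:
  fixes \<Phi> :: "'a::euclidean_space \<Rightarrow> 'b::euclidean_space"
  assumes der: "\<And>x. (\<Phi> has_derivative \<Phi>' x) (at x)"
    and D: "convex D" "closed D" "\<Phi> p \<in> D"
    and \<zeta>: "\<zeta> \<in> regular_normal_cone (\<Phi> -` D) p" and e: "e > 0"
  obtains p' q \<eta> where "dist p' p < e" "q \<in> D" "dist q (\<Phi> p) < e"
    "\<And>w. w \<in> D \<Longrightarrow> \<eta> \<bullet> (w - q) \<le> 0" "\<And>h. \<bar>\<eta> \<bullet> \<Phi>' p' h - \<zeta> \<bullet> h\<bar> \<le> e * norm h"
proof -
  \<comment> \<open>Half of \<open>e\<close> is kept in reserve: the penalised function carries the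
    full weight \<open>e\<close>, and the difference forces the limit of the minimisers to be
    \<open>p\<close>.\<close>
  have "\<forall>\<^sub>F x in nhds p. x \<in> \<Phi> -` D \<longrightarrow> \<zeta> \<bullet> (x - p) \<le> e/2 * norm (x - p)"
    using \<zeta> e unfolding regular_normal_cone_iff by (meson half_gt_zero)
  then obtain r0 where r0: "r0 > 0"
    "\<And>x. dist x p < r0 \<Longrightarrow> x \<in> \<Phi> -` D \<Longrightarrow> \<zeta> \<bullet> (x - p) \<le> e/2 * norm (x - p)"
    unfolding eventually_nhds_metric by blast
  \<comment> \<open>Halving makes the closed, hence compact, ball fit into the
    neighbourhood.\<close>
  define r where "r = r0/2"
  have r: "r > 0" "\<And>x. x \<in> cball p r \<Longrightarrow> \<Phi> x \<in> D \<Longrightarrow> \<zeta> \<bullet> (x - p) \<le> e/2 * norm (x - p)"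
    using r0 by (auto simp: r_def dist_commute)
  have cont: "continuous_on S \<Phi>" for S
    using der by (meson continuous_at_imp_continuous_on has_derivative_continuous)
  have Dne: "D \<noteq> {}" using D by auto
  define \<psi> where "\<psi> k x = - (\<zeta> \<bullet> (x - p)) + e * norm (x - p) + real k * (setdist {\<Phi> x} D)\<^sup>2" for k x
  have "continuous_on (cball p r) (\<lambda>x. setdist {\<Phi> x} D)"
    by (rule continuous_on_compose2[OF continuous_on_setdist cont subset_UNIV])
  then have "continuous_on (cball p r) (\<psi> k)" for k
    unfolding \<psi>_def by (intro continuous_intros)
  then have "\<exists>x\<in>cball p r. \<forall>y\<in>cball p r. \<psi> k x \<le> \<psi> k y" for k
    using r by (intro continuous_attains_inf) auto
  then obtain P where P: "\<And>k. P k \<in> cball p r" "\<And>k y. y \<in> cball p r \<Longrightarrow> \<psi> k (P k) \<le> \<psi> k y"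
    by metis
  have "\<psi> k p = 0" for k using D by (simp add: \<psi>_def setdist_eq_0I)
  then have P0: "\<psi> k (P k) \<le> 0" for k using P(2)[of p k] r by simp
  obtain x0 s where x0: "x0 \<in> cball p r" and s: "strict_mono (s :: nat \<Rightarrow> nat)" and lim: "(P \<circ> s) \<longlonglongrightarrow> x0"
    using compact_cball[of p r] P(1) unfolding compact_def by meson
  have \<Phi>lim: "(\<lambda>k. \<Phi> (P (s k))) \<longlonglongrightarrow> \<Phi> x0"
    using lim cont[of UNIV] by (auto simp: o_def intro: continuous_on_tendsto_compose)
  have dlim: "(\<lambda>k. (setdist {\<Phi> (P (s k))} D)\<^sup>2) \<longlonglongrightarrow> (setdist {\<Phi> x0} D)\<^sup>2"
    by (intro tendsto_intros isCont_tendsto_compose[OF continuous_at_setdist \<Phi>lim])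
  \<comment> \<open>The value at \<open>p\<close> is zero for every \<open>k\<close>; comparison
    with it bounds the penalty uniformly, so the squared distance to \<open>D\<close> is of order
    \<open>1 / k\<close>.\<close>
  have bnd: "real k * (setdist {\<Phi> (P k)} D)\<^sup>2 \<le> norm \<zeta> * r" for k
  proof -
    have "real k * (setdist {\<Phi> (P k)} D)\<^sup>2 \<le> \<zeta> \<bullet> (P k - p) - e * norm (P k - p)"
      using P0[of k] by (simp add: \<psi>_def)
    also have "\<dots> \<le> norm \<zeta> * norm (P k - p)"
      using norm_cauchy_schwarz[of \<zeta> "P k - p"] e by (smt (verit) mult_nonneg_nonneg norm_ge_zero)
    also have "\<dots> \<le> norm \<zeta> * r"
      using P(1)[of k] by (intro mult_left_mono) (auto simp: dist_norm norm_minus_commute)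
    finally show ?thesis .
  qed
  have "(\<lambda>k. norm \<zeta> * r / real (s k)) \<longlonglongrightarrow> 0"
    using filterlim_compose[OF lim_const_over_n filterlim_subseq[OF s]] by auto
  moreover have "\<forall>\<^sub>F k in sequentially. (setdist {\<Phi> (P (s k))} D)\<^sup>2 \<le> norm \<zeta> * r / real (s k)"
    using eventually_gt_at_top[of 0]
  proof eventually_elim
    case (elim k)
    then have "s k > 0" using seq_suble[OF s, of k] by linarith
    then show ?case using bnd[of "s k"] by (simp add: field_simps)
  qed
  ultimately have "(setdist {\<Phi> x0} D)\<^sup>2 \<le> 0"
    by (intro tendsto_le[OF _ _ dlim]) auto
  then have "\<Phi> x0 \<in> D" using D Dne by (auto simp: setdist_eq_0_closed)
  then have "\<zeta> \<bullet> (x0 - p) \<le> e/2 * norm (x0 - p)" using r x0 by blast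
  moreover have "e * norm (x0 - p) \<le> \<zeta> \<bullet> (x0 - p)"
  proof (rule LIMSEQ_le)
    show "(\<lambda>k. e * norm ((P \<circ> s) k - p)) \<longlonglongrightarrow> e * norm (x0 - p)" by (intro tendsto_intros lim)
    show "(\<lambda>k. \<zeta> \<bullet> ((P \<circ> s) k - p)) \<longlonglongrightarrow> \<zeta> \<bullet> (x0 - p)" by (intro tendsto_intros lim)
    have "e * norm (P k - p) \<le> \<zeta> \<bullet> (P k - p)" for k
    proof -
      have "0 \<le> real k * (setdist {\<Phi> (P k)} D)\<^sup>2" by simp
      then show ?thesis using P0[of k] unfolding \<psi>_def by linarith
    qed
    then show "\<exists>N. \<forall>k\<ge>N. e * norm ((P \<circ> s) k - p) \<le> \<zeta> \<bullet> ((P \<circ> s) k - p)" by simp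
  qed
  ultimately have "e/2 * norm (x0 - p) \<le> 0" by linarith
  then have [simp]: "x0 = p" using e by (simp add: mult_le_0_iff)
  have "(\<lambda>k. closest_point D (\<Phi> (P (s k)))) \<longlonglongrightarrow> closest_point D (\<Phi> x0)"
    using continuous_at_closest_point[OF D(1,2) Dne] \<Phi>lim by (rule isCont_tendsto_compose)
  then have cl: "(\<lambda>k. closest_point D (\<Phi> (P (s k)))) \<longlonglongrightarrow> \<Phi> p"
    using D by (simp add: closest_point_self)
  \<comment> \<open>The bound \<open>e\<close> is the required accuracy, while \<open>r\<close> puts
    the minimiser into the interior of the ball, where minimality is a local property.\<close>
  have ev0: "\<forall>\<^sub>F k in sequentially. dist (P (s k)) p < min r e \<and> dist (closest_point D (\<Phi> (P (s k)))) (\<Phi> p) < e"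
  proof (rule eventually_conj)
    show "\<forall>\<^sub>F k in sequentially. dist (P (s k)) p < min r e"
      using tendstoD[OF lim, of "min r e"] r e by simp
  qed (rule tendstoD[OF cl e])
  then obtain j where j: "dist (P (s j)) p < min r e" "dist (closest_point D (\<Phi> (P (s j)))) (\<Phi> p) < e"
    using eventually_happens'[OF sequentially_bot ev0] by (elim exE conjE)
  \<comment> \<open>\<open>\<eta>\<close> is the gradient at \<open>\<Phi> x\<close> of
    \<open>k\<close> times the squared distance to the fixed point \<open>q\<close>. As a
    nonnegative multiple of a point minus its projection it is normal to \<open>D\<close> at
    \<open>q\<close>.\<close>
  define k x q \<eta> where "k = s j" and "x = P k" and "q = closest_point D (\<Phi> x)"
    and "\<eta> = (2 * real k) *\<^sub>R (\<Phi> x - q)"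
  have q: "q \<in> D" using closest_point_in_set[OF D(2) Dne] by (simp add: q_def)
  define \<theta> where "\<theta> y = - (\<zeta> \<bullet> (y - p)) + real k * ((\<Phi> y - q) \<bullet> (\<Phi> y - q))" for y
  have \<theta>der: "(\<theta> has_derivative (\<lambda>h. \<eta> \<bullet> \<Phi>' x h - \<zeta> \<bullet> h)) (at x)"
    unfolding \<theta>_def \<eta>_def
    by (rule derivative_eq_intros der refl)+ (simp add: inner_commute inner_diff_left inner_diff_right algebra_simps)
  have "\<theta> x \<le> \<theta> y + e * norm (y - x)" if y: "y \<in> cball p r" for y
  proof -
    have "setdist {\<Phi> x} D = dist (\<Phi> x) q"
      unfolding q_def by (rule setdist_closest_point[OF D(2) Dne])
    then have 1: "\<psi> k x = \<theta> x + e * norm (x - p)"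
      by (simp add: \<psi>_def \<theta>_def dist_norm power2_norm_eq_inner)
    have "setdist {\<Phi> y} D \<le> dist (\<Phi> y) q" using q by (intro setdist_le_dist) auto
    then have "(setdist {\<Phi> y} D)\<^sup>2 \<le> (dist (\<Phi> y) q)\<^sup>2" by (intro power_mono) auto
    then have "real k * (setdist {\<Phi> y} D)\<^sup>2 \<le> real k * (dist (\<Phi> y) q)\<^sup>2" by (intro mult_left_mono) auto
    then have 2: "\<psi> k y \<le> \<theta> y + e * norm (y - p)"
      by (simp add: \<psi>_def \<theta>_def dist_norm power2_norm_eq_inner)
    have "norm (y - p) \<le> norm (y - x) + norm (x - p)"
      using norm_triangle_ineq[of "y - x" "x - p"] by simp
    then have "e * norm (y - p) \<le> e * norm (y - x) + e * norm (x - p)"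
      using e by (simp flip: distrib_left)
    then show ?thesis using 1 2 P(2)[OF y, of k] by (simp add: x_def)
  qed
  moreover have "\<forall>\<^sub>F y in nhds x. y \<in> ball p r"
    using j(1) by (intro eventually_nhds_in_open) (auto simp: x_def k_def dist_commute)
  ultimately have ev: "\<forall>\<^sub>F y in nhds x. \<theta> x \<le> \<theta> y + e * norm (y - x)"
    by (auto elim: eventually_mono)
  have lb: "- e * norm h \<le> \<eta> \<bullet> \<Phi>' x h - \<zeta> \<bullet> h" for h
    by (rule derivative_ge_of_sharp_minimum[OF \<theta>der ev])
  have "\<Phi>' x (- h) = - \<Phi>' x h" for h
    using der[of x] by (intro linear_neg has_derivative_linear)
  then have "\<bar>\<eta> \<bullet> \<Phi>' x h - \<zeta> \<bullet> h\<bar> \<le> e * norm h" for h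
    using lb[of h] lb[of "- h"] by (simp add: abs_le_iff)
  moreover have "\<eta> \<bullet> (w - q) \<le> 0" if "w \<in> D" for w
    using closest_point_dot[OF D(1,2) that, of "\<Phi> x"]
    by (simp add: \<eta>_def q_def mult_nonneg_nonpos)
  ultimately show thesis using that[of x q \<eta>] j q by (auto simp: x_def q_def k_def)
qed

section \<open>Subdifferentials of convex functions\<close>

lemma epi_iff [simp]: "(z, r) \<in> epi h \<longleftrightarrow> h z \<le> ereal r"
  by (simp add: epi_def)

lemma proper_finite: "proper h \<Longrightarrow> h z \<le> ereal r \<Longrightarrow> \<bar>h z\<bar> \<noteq> \<infinity>"
  unfolding proper_def by (cases "h z") auto

lemma proper_obtain:
  assumes "proper h"
  obtains z r where "h z \<le> ereal r"
proof -
  obtain z where "h z \<noteq> \<infinity>" "h z \<noteq> - \<infinity>" using assms unfolding proper_def by blast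
  then have "h z \<le> ereal (real_of_ereal (h z))" by (cases "h z") auto
  then show thesis by (rule that)
qed

lemma lower_semicont_eventually_gt:
  assumes "lower_semicont h" "c < h z"
  shows "\<forall>\<^sub>F w in nhds z. c < h w"
proof -
  have "c < Liminf (at z) h" using assms unfolding lower_semicont_def by (meson less_le_trans)
  then have "\<forall>\<^sub>F w in at z. c < h w" by (rule less_LiminfD)
  then show ?thesis
    unfolding eventually_at_filter by eventually_elim (use assms(2) in auto)
qed

lemma closed_epi:
  assumes lsc: "lower_semicont h"
  shows "closed (epi h)"
proof -
  have "\<exists>T. open T \<and> p \<in> T \<and> T \<subseteq> - epi h" if p: "p \<in> - epi h" for p
  proof -
    obtain z r where [simp]: "p = (z, r)" by (cases p)
    have "ereal r < h z" using p by simp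
    \<comment> \<open>A level strictly between \<open>r\<close> and \<open>h z\<close> leaves room
      in both coordinates, so a product neighbourhood misses the epigraph.\<close>
    then obtain c where c: "r < c" "ereal c < h z"
      by (metis ereal_dense2 ereal_less(2) less_ereal.simps(1))
    obtain U where U: "open U" "z \<in> U" "\<And>w. w \<in> U \<Longrightarrow> ereal c < h w"
      using lower_semicont_eventually_gt[OF lsc c(2)] unfolding eventually_nhds by blast
    have "U \<times> {..<c} \<subseteq> - epi h"
    proof
      fix q assume "q \<in> U \<times> {..<c}"
      then obtain w s where [simp]: "q = (w, s)" and "w \<in> U" "s < c" by auto
      then have "ereal s < h w" using U(3)[of w] by (meson less_ereal.simps(1) less_trans)
      then show "q \<in> - epi h" by simp
    qed
    then show ?thesis using U c by (intro exI[of _ "U \<times> {..<c}"]) (auto intro: open_Times)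
  qed
  then show ?thesis unfolding closed_def by (subst open_subopen) blast
qed

text \<open>By convexity the limiting normal cone of the epigraph is given by a global inequality.
  Quantifying over real \<open>s\<close> above \<open>g w\<close> lets points with
  \<open>g w = \<infinity>\<close> impose nothing.\<close>

lemma limiting_subdiff_convex_iff:
  assumes "proper g" "convex_fun g"
  shows "y \<in> limiting_subdiff g z \<longleftrightarrow>
    \<bar>g z\<bar> \<noteq> \<infinity> \<and> (\<forall>w s. g w \<le> ereal s \<longrightarrow> g z \<le> ereal (s - y \<bullet> (w - z)))"
proof (cases "\<bar>g z\<bar> = \<infinity>")
  case True
  then show ?thesis by (simp add: limiting_subdiff_def)
next
  case False
  then obtain a where a: "g z = ereal a" by (cases "g z") auto
  have "limiting_normal_cone (epi g) (z, a) = {\<zeta>. \<forall>w\<in>epi g. \<zeta> \<bullet> (w - (z, a)) \<le> 0}"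
    using assms a by (intro limiting_normal_cone_convex) (auto simp: convex_fun_def)
  then show ?thesis
    by (auto simp: limiting_subdiff_def a Ball_def split_paired_All algebra_simps)
qed

text \<open>For convex \<open>g\<close> the horizontal normals of the epigraph are the normals of
  its domain; \<open>s\<close> only expresses that \<open>w\<close> lies in the domain.\<close>

lemma singular_subdiff_convexI:
  assumes "convex_fun g" "\<bar>g z\<bar> \<noteq> \<infinity>" "\<And>w s. g w \<le> ereal s \<Longrightarrow> y \<bullet> (w - z) \<le> 0"
  shows "y \<in> singular_subdiff g z"
proof -
  obtain a where a: "g z = ereal a" using assms(2) by (cases "g z") auto
  have "limiting_normal_cone (epi g) (z, a) = {\<zeta>. \<forall>w\<in>epi g. \<zeta> \<bullet> (w - (z, a)) \<le> 0}"
    using assms(1) a by (intro limiting_normal_cone_convex) (auto simp: convex_fun_def)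
  then show ?thesis
    using assms(3) by (auto simp: singular_subdiff_def a)
qed

lemma limiting_subdiff_convex_closed:
  assumes g: "proper g" "convex_fun g" "lower_semicont g"
    and lim: "Z \<longlonglongrightarrow> z" "Y \<longlonglongrightarrow> y"
    and ev: "\<forall>\<^sub>F k in sequentially. Y k \<in> limiting_subdiff g (Z k)"
  shows "y \<in> limiting_subdiff g z"
proof -
  have *: "g z \<le> ereal (s - y \<bullet> (w - z))" if "g w \<le> ereal s" for w s
  proof -
    have "\<forall>\<^sub>F k in sequentially. (Z k, s - Y k \<bullet> (w - Z k)) \<in> epi g"
      using ev by eventually_elim (use that in \<open>auto simp: limiting_subdiff_convex_iff[OF g(1,2)]\<close>)
    moreover have "(\<lambda>k. (Z k, s - Y k \<bullet> (w - Z k))) \<longlonglongrightarrow> (z, s - y \<bullet> (w - z))"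
      by (intro tendsto_intros lim)
    ultimately have "(z, s - y \<bullet> (w - z)) \<in> epi g"
      using closed_epi[OF g(3)] by (intro Lim_in_closed_set[where F = sequentially]) auto
    then show ?thesis by simp
  qed
  obtain w s where "g w \<le> ereal s" using proper_obtain[OF g(1)] .
  then have "\<bar>g z\<bar> \<noteq> \<infinity>" by (rule proper_finite[OF g(1) *])
  then show ?thesis using * by (simp add: limiting_subdiff_convex_iff[OF g(1,2)])
qed

text \<open>The inequality is that of a regular (Frechet) subgradient; its error is measured in
  \<open>w\<close> alone, which is at most the error allowed for a normal of the epigraph.\<close>

lemma regular_subgradient_limiting:
  fixes h :: "'a::euclidean_space \<Rightarrow> ereal"
  assumes fin: "\<bar>h z\<bar> \<noteq> \<infinity>"
    and ev: "\<And>\<epsilon>. \<epsilon> > 0 \<Longrightarrow> \<forall>\<^sub>F w in nhds z. \<forall>r. h w \<le> ereal r \<longrightarrow>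
       real_of_ereal (h z) + \<zeta> \<bullet> (w - z) - \<epsilon> * norm (w - z) \<le> r"
  shows "\<zeta> \<in> limiting_subdiff h z"
proof -
  obtain a where a: "h z = ereal a" using fin by (cases "h z") auto
  have "(\<zeta>, -1) \<in> regular_normal_cone (epi h) (z, a)"
    unfolding regular_normal_cone_iff
  proof (intro allI impI)
    fix \<epsilon> :: real assume e: "\<epsilon> > 0"
    have "(fst \<longlongrightarrow> z) (nhds (z, a))"
      using tendsto_fst[OF filterlim_ident[of "nhds (z, a)"]] by simp
    from filterlim_iff[THEN iffD1, rule_format, OF this ev[OF e]]
    show "\<forall>\<^sub>F p in nhds (z, a). p \<in> epi h \<longrightarrow> (\<zeta>, -1) \<bullet> (p - (z, a)) \<le> \<epsilon> * norm (p - (z, a))"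
    proof eventually_elim
      case (elim p)
      obtain w r where [simp]: "p = (w, r)" by (cases p)
      show ?case
      proof
        assume "p \<in> epi h"
        then have "\<zeta> \<bullet> (w - z) - (r - a) \<le> \<epsilon> * norm (w - z)" using elim by (auto simp: a)
        also have "\<dots> \<le> \<epsilon> * norm (p - (z, a))"
          using e norm_fst_le[of "w - z" "r - a"] by (intro mult_left_mono) auto
        finally show "(\<zeta>, -1) \<bullet> (p - (z, a)) \<le> \<epsilon> * norm (p - (z, a))" by simp
      qed
    qed
  qed
  then have "(\<zeta>, -1) \<in> limiting_normal_cone (epi h) (z, a)"
    by (intro regular_normal_limiting) (simp_all add: a)
  then show ?thesis using fin by (simp add: limiting_subdiff_def a)
qed

text \<open>\<open>gradient\<close> is a definite description, so existence and uniqueness have to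
  be supplied. The sum over \<open>Basis\<close> gives both, and reduces limits and derivatives of
  gradients to those of directional derivatives.\<close>

lemma
  fixes \<phi> :: "'a::euclidean_space \<Rightarrow> real"
  assumes der: "(\<phi> has_derivative \<phi>') (at x)"
  shows gradient_eq_sum: "gradient \<phi> x = (\<Sum>b\<in>Basis. \<phi>' b *\<^sub>R b)"
    and gradient_inner: "gradient \<phi> x \<bullet> h = \<phi>' h"
proof -
  interpret linear \<phi>' using der by (rule has_derivative_linear)
  define D where "D = (\<Sum>b\<in>Basis. \<phi>' b *\<^sub>R b)"
  have D: "\<phi>' h = h \<bullet> D" for h :: 'a
  proof -
    have "\<phi>' h = \<phi>' (\<Sum>b\<in>Basis. (h \<bullet> b) *\<^sub>R b)" by (simp add: euclidean_representation)
    also have "\<dots> = h \<bullet> D" by (simp add: sum scale D_def inner_sum_right mult.commute)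
    finally show ?thesis .
  qed
  have "gradient \<phi> x = D"
    unfolding gradient_def
  proof (rule the_equality)
    show "GDERIV \<phi> x :> D"
      using der unfolding gderiv_def D[symmetric] by simp
    fix E assume "GDERIV \<phi> x :> E"
    then have "(\<lambda>h. h \<bullet> E) = \<phi>'"
      using der unfolding gderiv_def by (rule has_derivative_unique)
    then have "h \<bullet> E = h \<bullet> D" for h unfolding D[symmetric] by (rule fun_cong)
    then show "E = D" by (rule vector_eq_ldot[THEN iffD1, OF allI])
  qed
  then show "gradient \<phi> x = (\<Sum>b\<in>Basis. \<phi>' b *\<^sub>R b)" unfolding D_def .
  show "gradient \<phi> x \<bullet> h = \<phi>' h"
    unfolding \<open>gradient \<phi> x = D\<close> D by (rule inner_commute)
qed

section \<open>The composite function and its multipliers\<close>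

text \<open>Second-order smoothness is recorded one direction \<open>b\<close> at a time, the form
  that matches the basis expansion of the gradient of the Lagrangian.\<close>

locale smooth_composite =
  fixes f0 :: "real^'n \<Rightarrow> real" and F :: "real^'n \<Rightarrow> real^'m" and g :: "real^'m \<Rightarrow> ereal"
    and f0' :: "real^'n \<Rightarrow> real^'n \<Rightarrow> real" and F' :: "real^'n \<Rightarrow> real^'n \<Rightarrow> real^'m"
  assumes der_f0: "\<And>x. (f0 has_derivative f0' x) (at x)"
    and der_F: "\<And>x. (F has_derivative F' x) (at x)"
    and diff_f0': "\<And>x b. (\<lambda>x. f0' x b) differentiable (at x)"
    and diff_F': "\<And>x b. (\<lambda>x. F' x b) differentiable (at x)"
    and proper: "proper g" and lsc: "lower_semicont g" and convex: "convex_fun g"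
begin

abbreviation gradL :: "real^'m \<Rightarrow> real^'n \<Rightarrow> real^'n" where
  "gradL y \<equiv> gradient (\<lambda>x. lagrangian f0 F x y)"

lemmas subdiff_iff = limiting_subdiff_convex_iff[OF proper convex]
lemmas subdiff_closed = limiting_subdiff_convex_closed[OF proper convex lsc]

section \<open>Limits and derivatives of the gradient of the Lagrangian\<close>

lemma F_tendsto: "X \<longlonglongrightarrow> x \<Longrightarrow> (\<lambda>k. F (X k)) \<longlonglongrightarrow> F x"
  by (rule isCont_tendsto_compose[OF has_derivative_continuous[OF der_F]])

lemma f0_tendsto: "X \<longlonglongrightarrow> x \<Longrightarrow> (\<lambda>k. f0 (X k)) \<longlonglongrightarrow> f0 x"
  by (rule isCont_tendsto_compose[OF has_derivative_continuous[OF der_f0]])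

lemma F'_tendsto: "X \<longlonglongrightarrow> x \<Longrightarrow> (\<lambda>k. F' (X k) b) \<longlonglongrightarrow> F' x b"
  by (rule isCont_tendsto_compose[OF differentiable_imp_continuous_within[OF diff_F']])

lemma f0'_tendsto: "X \<longlonglongrightarrow> x \<Longrightarrow> (\<lambda>k. f0' (X k) b) \<longlonglongrightarrow> f0' x b"
  by (rule isCont_tendsto_compose[OF differentiable_imp_continuous_within[OF diff_f0']])

lemma der_lagrangian:
  "((\<lambda>x. lagrangian f0 F x y) has_derivative (\<lambda>h. f0' x h + y \<bullet> F' x h)) (at x)"
  unfolding lagrangian_def by (intro derivative_intros der_f0 der_F)

lemma gradL_inner: "gradL y x \<bullet> h = f0' x h + y \<bullet> F' x h"
  by (rule gradient_inner[OF der_lagrangian])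

lemma gradL_eq: "gradL y x = (\<Sum>b\<in>Basis. (f0' x b + y \<bullet> F' x b) *\<^sub>R b)"
  by (rule gradient_eq_sum[OF der_lagrangian])

lemma jacobian_mult: "jacobian F (at x) *v h = F' x h"
proof -
  have "F differentiable (at x)" using der_F by (rule differentiableI)
  then have "(F has_derivative (\<lambda>h. jacobian F (at x) *v h)) (at x)" by (simp add: jacobian_works)
  from has_derivative_unique[OF this der_F] show ?thesis by (rule fun_cong)
qed

lemma transpose_jacobian_inner: "(transpose (jacobian F (at x)) *v y) \<bullet> h = y \<bullet> F' x h"
  by (simp add: dot_lmul_matrix jacobian_mult)

lemma transpose_jacobian_eq: "transpose (jacobian F (at x)) *v y = (\<Sum>b\<in>Basis. (y \<bullet> F' x b) *\<^sub>R b)"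
  by (subst euclidean_representation[symmetric]) (simp only: transpose_jacobian_inner)

lemma gradL_diff: "gradL y x - gradL y' x = transpose (jacobian F (at x)) *v (y - y')"
  by (simp only: gradL_eq transpose_jacobian_eq)
    (simp add: algebra_simps inner_diff_left flip: sum_subtractf)

lemma gradL_tendsto:
  assumes "X \<longlonglongrightarrow> x" "Y \<longlonglongrightarrow> y"
  shows "(\<lambda>k. gradL (Y k) (X k)) \<longlonglongrightarrow> gradL y x"
  unfolding gradL_eq using assms by (intro tendsto_intros F'_tendsto f0'_tendsto)

lemma transpose_jacobian_tendsto:
  assumes "X \<longlonglongrightarrow> x" "Y \<longlonglongrightarrow> y"
  shows "(\<lambda>k. transpose (jacobian F (at (X k))) *v Y k) \<longlonglongrightarrow> transpose (jacobian F (at x)) *v y"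
  unfolding transpose_jacobian_eq using assms by (intro tendsto_intros F'_tendsto)

text \<open>\<open>hessian\<close> is the Jacobian of the gradient and represents a derivative only
  once the gradient is known to be differentiable; the basis expansion shows this.\<close>

lemma der_gradL:
  "(gradL y has_derivative (\<lambda>h. hessian (\<lambda>x. lagrangian f0 F x y) x *v h)) (at x)"
proof -
  have "(\<lambda>x. (f0' x b + y \<bullet> F' x b) *\<^sub>R b) differentiable (at x)" for b
  proof -
    obtain D1 D2 where D: "((\<lambda>x. f0' x b) has_derivative D1) (at x)" "((\<lambda>x. F' x b) has_derivative D2) (at x)"
      using diff_f0'[of b x] diff_F'[of b x] unfolding differentiable_def by blast
    show ?thesis by (rule differentiableI) (rule derivative_eq_intros D refl)+
  qed
  then have "gradL y differentiable (at x)"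
    unfolding gradL_eq by (intro differentiable_sum) auto
  then show ?thesis by (simp add: jacobian_works hessian_def)
qed

text \<open>Moving \<open>x\<close> with \<open>y\<close> fixed contributes the Hessian term. Moving
  \<open>y\<close> at the displaced point contributes the Jacobian term with no remainder, because
  the Lagrangian is affine in \<open>y\<close>. The limit is the left-hand side of the equation in
  \<open>noncritical\<close>.\<close>

lemma gradL_quotient_tendsto:
  assumes t: "\<And>k. 0 < t k" "t \<longlonglongrightarrow> 0" and d: "d \<longlonglongrightarrow> d0" and e: "e \<longlonglongrightarrow> e0"
  shows "(\<lambda>k. (gradL (y + t k *\<^sub>R e k) (x + t k *\<^sub>R d k) - gradL y x) /\<^sub>R t k)
    \<longlonglongrightarrow> hessian (\<lambda>x. lagrangian f0 F x y) x *v d0 + transpose (jacobian F (at x)) *v e0"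
proof -
  have "(\<lambda>k. x + t k *\<^sub>R d k) \<longlonglongrightarrow> x + 0 *\<^sub>R d0" by (intro tendsto_intros t d)
  then have "(\<lambda>k. (gradL y (x + t k *\<^sub>R d k) - gradL y x) /\<^sub>R t k
        + transpose (jacobian F (at (x + t k *\<^sub>R d k))) *v e k)
    \<longlonglongrightarrow> hessian (\<lambda>x. lagrangian f0 F x y) x *v d0 + transpose (jacobian F (at x)) *v e0"
    by (intro tendsto_add has_derivative_quotient_tendsto[OF der_gradL d t] transpose_jacobian_tendsto e)
      simp
  moreover have "(gradL (y + t k *\<^sub>R e k) (x + t k *\<^sub>R d k) - gradL y x) /\<^sub>R t k
      = (gradL y (x + t k *\<^sub>R d k) - gradL y x) /\<^sub>R t k
        + transpose (jacobian F (at (x + t k *\<^sub>R d k))) *v e k" for k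
  proof -
    let ?x = "x + t k *\<^sub>R d k" and ?y = "y + t k *\<^sub>R e k"
    have "gradL ?y ?x - gradL y ?x = t k *\<^sub>R (transpose (jacobian F (at ?x)) *v e k)"
      unfolding gradL_diff by (simp only: add_diff_cancel_left' matrix_vector_mult_scaleR)
    then have "gradL ?y ?x - gradL y x
        = (gradL y ?x - gradL y x) + t k *\<^sub>R (transpose (jacobian F (at ?x)) *v e k)"
      by (simp only: algebra_simps)
    then show ?thesis using t(1)[of k] by (simp add: scaleR_add_right scaleR_diff_right del: transpose_matrix_vector)
  qed
  ultimately show ?thesis by (simp only:)
qed

section \<open>Subgradients and epigraph normals of the composite function\<close>

lemma composite_le_iff: "composite f0 F g x u \<le> ereal r \<longleftrightarrow> g (F x + u) \<le> ereal (r - f0 x)"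
  unfolding composite_def by (cases "g (F x + u)") (auto simp: algebra_simps)

lemma composite_finite_iff: "\<bar>composite f0 F g x u\<bar> \<noteq> \<infinity> \<longleftrightarrow> \<bar>g (F x + u)\<bar> \<noteq> \<infinity>"
  unfolding composite_def by (cases "g (F x + u)") auto

lemma real_of_composite:
  "\<bar>g (F x + u)\<bar> \<noteq> \<infinity> \<Longrightarrow> real_of_ereal (composite f0 F g x u) = f0 x + real_of_ereal (g (F x + u))"
  unfolding composite_def by (cases "g (F x + u)") auto

text \<open>Add the subgradient inequality of \<open>g\<close> between \<open>F x + u\<close> and
  \<open>F x' + u'\<close> to the first-order expansion of the Lagrangian. The former is global, so
  \<open>u'\<close> is unrestricted and the error involves \<open>x' - x\<close> only; this serves
  both the partial and the joint subdifferential.\<close>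

lemma composite_lower_bound:
  assumes y: "y \<in> limiting_subdiff g (F x + u)" and \<epsilon>: "\<epsilon> > 0"
  shows "\<forall>\<^sub>F x' in nhds x. \<forall>u' r. composite f0 F g x' u' \<le> ereal r \<longrightarrow>
    real_of_ereal (composite f0 F g x u) + gradL y x \<bullet> (x' - x) + y \<bullet> (u' - u)
      - \<epsilon> * norm (x' - x) \<le> r"
proof -
  let ?L = "\<lambda>x. lagrangian f0 F x y"
  obtain a where a: "g (F x + u) = ereal a"
    using y subdiff_iff by (cases "g (F x + u)") auto
  have "\<exists>d>0. \<forall>x'. norm (x' - x) < d \<longrightarrow>
      norm (?L x' - ?L x - (f0' x (x' - x) + y \<bullet> F' x (x' - x))) \<le> \<epsilon> * norm (x' - x)"
    using der_lagrangian[of y x] \<epsilon> unfolding has_derivative_at_alt by blast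
  then obtain d where "d > 0" and d: "\<And>x'. norm (x' - x) < d \<Longrightarrow>
      norm (?L x' - ?L x - gradL y x \<bullet> (x' - x)) \<le> \<epsilon> * norm (x' - x)"
    unfolding gradL_inner by blast
  have "f0 x + a + gradL y x \<bullet> (x' - x) + y \<bullet> (u' - u) - \<epsilon> * norm (x' - x) \<le> r"
    if x': "dist x' x < d" and r: "composite f0 F g x' u' \<le> ereal r" for x' u' r
  proof -
    have "g (F x' + u') \<le> ereal (r - f0 x')" using r by (simp add: composite_le_iff)
    then have "ereal a \<le> ereal (r - f0 x' - y \<bullet> (F x' + u' - (F x + u)))"
      using y unfolding subdiff_iff a by blast
    then have 1: "a + y \<bullet> (F x' + u' - (F x + u)) \<le> r - f0 x'" by simp
    have "gradL y x \<bullet> (x' - x) - \<epsilon> * norm (x' - x) \<le> ?L x' - ?L x"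
      using d[of x'] x' by (simp add: dist_norm abs_le_iff)
    then show ?thesis using 1 by (simp add: lagrangian_def algebra_simps)
  qed
  then show ?thesis
    unfolding eventually_nhds_metric using \<open>d > 0\<close>
    by (intro exI[of _ d]) (auto simp: real_of_composite a)
qed

text \<open>The lower bound with \<open>u\<close> frozen: a multiplier certifies stationarity. The
  converse is the delicate direction.\<close>

lemma gradL_stationary:
  assumes y: "y \<in> limiting_subdiff g (F x + u)"
  shows "gradL y x \<in> limiting_subdiff (\<lambda>x. composite f0 F g x u) x"
proof (rule regular_subgradient_limiting)
  show "\<bar>composite f0 F g x u\<bar> \<noteq> \<infinity>"
    unfolding composite_finite_iff using y[unfolded subdiff_iff] by (rule conjunct1)
  fix \<epsilon> :: real assume "\<epsilon> > 0"
  from composite_lower_bound[OF y this]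
  show "\<forall>\<^sub>F w in nhds x. \<forall>r. composite f0 F g w u \<le> ereal r \<longrightarrow>
     real_of_ereal (composite f0 F g x u) + gradL y x \<bullet> (w - x) - \<epsilon> * norm (w - x) \<le> r"
  proof eventually_elim
    case (elim w)
    then show ?case using spec[OF elim, of u] by simp
  qed
qed

lemma gradL_multiplier:
  assumes y: "y \<in> limiting_subdiff g (F x + u)"
  shows "(gradL y x, y) \<in> limiting_subdiff (\<lambda>(x, u). composite f0 F g x u) (x, u)"
proof (rule regular_subgradient_limiting)
  show "\<bar>case (x, u) of (x, u) \<Rightarrow> composite f0 F g x u\<bar> \<noteq> \<infinity>"
    unfolding prod.case composite_finite_iff using y[unfolded subdiff_iff] by (rule conjunct1)
  fix \<epsilon> :: real assume \<epsilon>: "\<epsilon> > 0"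
  have "(fst \<longlongrightarrow> x) (nhds (x, u))"
    using tendsto_fst[OF filterlim_ident[of "nhds (x, u)"]] by simp
  from filterlim_iff[THEN iffD1, rule_format, OF this composite_lower_bound[OF y \<epsilon>]]
  show "\<forall>\<^sub>F w in nhds (x, u). \<forall>r. (case w of (x, u) \<Rightarrow> composite f0 F g x u) \<le> ereal r \<longrightarrow>
     real_of_ereal (case (x, u) of (x, u) \<Rightarrow> composite f0 F g x u)
       + (gradL y x, y) \<bullet> (w - (x, u)) - \<epsilon> * norm (w - (x, u)) \<le> r"
  proof eventually_elim
    case (elim w)
    obtain x' u' where w: "w = (x', u')" by (cases w)
    have "\<epsilon> * norm (x' - x) \<le> \<epsilon> * norm (w - (x, u))"
      using \<epsilon> norm_fst_le[of "x' - x" "u' - u"] by (intro mult_left_mono) (auto simp: w)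
    then show ?case using elim by (force simp: w)
  qed
qed

text \<open>Two families of tangent directions of the epigraph determine its normals: those that move
  only \<open>u\<close> and the function value, and those along which \<open>F x + u\<close> stays constant.\<close>

lemma regular_normal_composite:
  assumes n: "((v, y), \<gamma>) \<in> regular_normal_cone (epi (\<lambda>(x, u). composite f0 F g x u)) ((x, u), r)"
    and r: "composite f0 F g x u \<le> ereal r"
  shows "g w \<le> ereal s \<Longrightarrow> y \<bullet> (w - (F x + u)) + \<gamma> * (s - (r - f0 x)) \<le> 0"
    and "v \<bullet> h = y \<bullet> F' x h - \<gamma> * f0' x h"
proof -
  define t where "t = (\<lambda>k. inverse (real (Suc k)))"
  have t: "\<And>k. t k > 0" "t \<longlonglongrightarrow> 0" "\<And>k. t k \<le> 1"
    unfolding t_def by (simp, rule LIMSEQ_inverse_real_of_nat, simp add: inverse_le_1_iff)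
  note polar = regular_normal_tangent_le[OF n tangent_coneI[OF _ t(1,2)]]
  have gr: "g (F x + u) \<le> ereal (r - f0 x)" using r by (simp add: composite_le_iff)
  {
    assume s: "g w \<le> ereal s"
    \<comment> \<open>Along this direction the argument of \<open>g\<close> and the height left for
      it run linearly from \<open>(F x + u, r - f0 x)\<close> to \<open>(w, s)\<close>, inside the
      convex epigraph of \<open>g\<close>.\<close>
    let ?d = "((0, w - (F x + u)), s - (r - f0 x))"
    have "((x, u), r) + t k *\<^sub>R ?d \<in> epi (\<lambda>(x, u). composite f0 F g x u)" for k
    proof -
      have "(1 - t k) *\<^sub>R (F x + u, r - f0 x) + t k *\<^sub>R (w, s) \<in> epi g"
        using convex gr s t(1,3)[of k] unfolding convex_fun_def by (intro convexD_alt) auto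
      then show ?thesis by (simp add: composite_le_iff algebra_simps)
    qed
    then have "((v, y), \<gamma>) \<bullet> ?d \<le> 0" by (intro polar[of "\<lambda>_. ?d"]) auto
    then show "y \<bullet> (w - (F x + u)) + \<gamma> * (s - (r - f0 x)) \<le> 0" by simp
  }
  have le: "v \<bullet> h - y \<bullet> F' x h + \<gamma> * f0' x h \<le> 0" for h
  proof -
    \<comment> \<open>The displacement of \<open>u\<close> compensates that of \<open>F\<close>
      exactly, and the height follows \<open>f0\<close> exactly, so these points lie in the epigraph
      before any limit is taken.\<close>
    define d where "d k = ((h, - ((F (x + t k *\<^sub>R h) - F x) /\<^sub>R t k)), (f0 (x + t k *\<^sub>R h) - f0 x) /\<^sub>R t k)" for k
    have "d \<longlonglongrightarrow> ((h, - F' x h), f0' x h)"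
      unfolding d_def
      by (intro tendsto_intros has_derivative_quotient_tendsto[OF der_F _ t(1,2)]
          has_derivative_quotient_tendsto[OF der_f0 _ t(1,2)])
    moreover have "((x, u), r) + t k *\<^sub>R d k \<in> epi (\<lambda>(x, u). composite f0 F g x u)" for k
    proof -
      have tt: "t k * (inverse (t k) * z) = z" for z using t(1)[of k] by (simp flip: mult.assoc)
      then show ?thesis using gr t(1)[of k] by (simp add: composite_le_iff d_def add.commute tt)
    qed
    ultimately have "((v, y), \<gamma>) \<bullet> ((h, - F' x h), f0' x h) \<le> 0" by (rule polar)
    then show ?thesis by simp
  qed
  \<comment> \<open>Testing with both \<open>h\<close> and \<open>- h\<close> upgrades the
    inequality to an equality.\<close>
  have "F' x (- h) = - F' x h" "f0' x (- h) = - f0' x h"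
    using der_F der_f0 by (auto intro!: linear_neg has_derivative_linear)
  then show "v \<bullet> h = y \<bullet> F' x h - \<gamma> * f0' x h"
    using le[of h] le[of "- h"] by simp
qed

text \<open>The relations satisfied by regular normals are continuous in base point, height and
  normal, so they pass to the limit; the last component tending to \<open>-1\<close> turns them into
  the subgradient inequality and the gradient equation.\<close>

lemma multiplier_map_iff:
  "y \<in> multiplier_map (composite f0 F g) (v, u, x) \<longleftrightarrow>
    gradL y x = v \<and> y \<in> limiting_subdiff g (F x + u)"
proof
  let ?f = "\<lambda>(x, u). composite f0 F g x u"
  assume "y \<in> multiplier_map (composite f0 F g) (v, u, x)"
  then have fin: "\<bar>g (F x + u)\<bar> \<noteq> \<infinity>"
    and lim: "((v, y), -1) \<in> limiting_normal_cone (epi ?f) ((x, u), real_of_ereal (composite f0 F g x u))"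
    by (simp_all add: multiplier_map_def limiting_subdiff_def composite_finite_iff)
  from fin obtain a where a: "g (F x + u) = ereal a" by (cases "g (F x + u)") auto
  from lim have "((v, y), -1) \<in> limiting_normal_cone (epi ?f) ((x, u), f0 x + a)"
    by (simp add: real_of_composite a)
  then obtain zk \<zeta>k where zk: "\<And>k. zk k \<in> epi ?f" "zk \<longlonglongrightarrow> ((x, u), f0 x + a)"
    and \<zeta>k: "\<And>k. \<zeta>k k \<in> regular_normal_cone (epi ?f) (zk k)" "\<zeta>k \<longlonglongrightarrow> ((v, y), -1)"
    unfolding limiting_normal_cone_def by blast
  define X U R V Y c where defs: "X k = fst (fst (zk k))" "U k = snd (fst (zk k))" "R k = snd (zk k)"
    "V k = fst (fst (\<zeta>k k))" "Y k = snd (fst (\<zeta>k k))" "c k = snd (\<zeta>k k)" for k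
  have lims: "X \<longlonglongrightarrow> x" "U \<longlonglongrightarrow> u" "R \<longlonglongrightarrow> f0 x + a" "V \<longlonglongrightarrow> v" "Y \<longlonglongrightarrow> y" "c \<longlonglongrightarrow> -1"
    using tendsto_fst[OF tendsto_fst[OF zk(2)]] tendsto_snd[OF tendsto_fst[OF zk(2)]] tendsto_snd[OF zk(2)]
      tendsto_fst[OF tendsto_fst[OF \<zeta>k(2)]] tendsto_snd[OF tendsto_fst[OF \<zeta>k(2)]] tendsto_snd[OF \<zeta>k(2)]
    by (simp_all add: defs[abs_def])
  have eqs: "zk k = ((X k, U k), R k)" "\<zeta>k k = ((V k, Y k), c k)" for k by (simp_all add: defs)
  have "composite f0 F g (X k) (U k) \<le> ereal (R k)" for k
    using zk(1)[of k] by (simp add: eqs)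
  note normal = regular_normal_composite[OF \<zeta>k(1)[unfolded eqs] this]
  have "y \<in> limiting_subdiff g (F x + u)"
    unfolding subdiff_iff a
  proof (intro conjI allI impI)
    fix w s assume s: "g w \<le> ereal s"
    have "(\<lambda>k. Y k \<bullet> (w - (F (X k) + U k)) + c k * (s - (R k - f0 (X k))))
        \<longlonglongrightarrow> y \<bullet> (w - (F x + u)) + (-1) * (s - ((f0 x + a) - f0 x))"
      by (intro tendsto_intros lims F_tendsto f0_tendsto)
    then have "y \<bullet> (w - (F x + u)) + (-1) * (s - ((f0 x + a) - f0 x)) \<le> 0"
      using normal(1)[OF s] by (intro LIMSEQ_le_const2) auto
    then show "ereal a \<le> ereal (s - y \<bullet> (w - (F x + u)))" by simp
  qed simp
  moreover have "gradL y x \<bullet> h = v \<bullet> h" for h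
  proof (rule LIMSEQ_unique[symmetric])
    show "(\<lambda>k. V k \<bullet> h) \<longlonglongrightarrow> v \<bullet> h" by (intro tendsto_intros lims)
    have "(\<lambda>k. Y k \<bullet> F' (X k) h - c k * f0' (X k) h) \<longlonglongrightarrow> y \<bullet> F' x h - (-1) * f0' x h"
      by (intro tendsto_intros lims F'_tendsto f0'_tendsto)
    then show "(\<lambda>k. V k \<bullet> h) \<longlonglongrightarrow> gradL y x \<bullet> h" by (simp add: normal(2) gradL_inner add.commute)
  qed
  then have "gradL y x = v" by (rule vector_eq_rdot[THEN iffD1, OF allI])
  ultimately show "gradL y x = v \<and> y \<in> limiting_subdiff g (F x + u)" by blast
next
  assume "gradL y x = v \<and> y \<in> limiting_subdiff g (F x + u)"
  then show "y \<in> multiplier_map (composite f0 F g) (v, u, x)"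
    using gradL_multiplier[of y x u] by (auto simp: multiplier_map_def)
qed

end

section \<open>Stationary points under the qualification condition\<close>

lemma LIMSEQ_of_dist_le:
  fixes P Q :: "nat \<Rightarrow> 'a::real_normed_vector"
  assumes "P \<longlonglongrightarrow> p" "\<And>k. dist (Q k) (P k) \<le> e k" "e \<longlonglongrightarrow> 0"
  shows "Q \<longlonglongrightarrow> p"
proof -
  have "(\<lambda>k. dist (Q k) (P k)) \<longlonglongrightarrow> 0"
    by (rule tendsto_sandwich[OF _ _ tendsto_const assms(3)]) (auto intro: always_eventually assms(2))
  then have "(\<lambda>k. Q k - P k) \<longlonglongrightarrow> 0" by (simp add: tendsto_norm_zero_iff dist_norm)
  from tendsto_add[OF this assms(1)] show ?thesis by simp
qed

lemma bounded_seq_convergent_subseq: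
  fixes Y :: "nat \<Rightarrow> 'a::heine_borel"
  assumes "\<forall>\<^sub>F k in sequentially. dist a (Y k) \<le> B"
  obtains y s where "strict_mono (s :: nat \<Rightarrow> nat)" "(\<lambda>k. Y (s k)) \<longlonglongrightarrow> y"
proof -
  obtain N where N: "\<And>k. N \<le> k \<Longrightarrow> dist a (Y k) \<le> B"
    using assms unfolding eventually_sequentially by blast
  have "bounded (range (\<lambda>k. Y (k + N)))"
    unfolding bounded_def by (rule exI[of _ a], rule exI[of _ B]) (auto intro: N)
  then obtain y s where "strict_mono s" "((\<lambda>k. Y (k + N)) \<circ> s) \<longlonglongrightarrow> y"
    using bounded_imp_convergent_subsequence by blast
  then show thesis
    by (intro that[of "\<lambda>k. s k + N" y]) (auto simp: strict_mono_def o_def)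
qed

context smooth_composite
begin

text \<open>The epigraph for frozen \<open>u\<close> is the preimage of \<open>epi g\<close> under
  \<open>(x, r) \<mapsto> (F x + u, r - f0 x)\<close>. The fuzzy preimage rule is applied to the
  \<open>k\<close>-th regular normal with accuracy \<open>1 / (k + 1)\<close>. The points
  \<open>Z k\<close> and \<open>F (X k) + u\<close> may differ; they only share their limit.\<close>

lemma stationary_fuzzy:
  assumes v: "v \<in> limiting_subdiff (\<lambda>x. composite f0 F g x u) x"
  obtains X Z Y where "X \<longlonglongrightarrow> x" "Z \<longlonglongrightarrow> F x + u"
    "\<forall>\<^sub>F k in sequentially. Y k \<in> limiting_subdiff g (Z k)"
    "(\<lambda>k. gradL (Y k) (X k)) \<longlonglongrightarrow> v"
proof -
  let ?f = "\<lambda>x. composite f0 F g x u"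
  obtain a where lim: "(v, -1) \<in> limiting_normal_cone (epi ?f) (x, a)"
    using v unfolding limiting_subdiff_def by blast
  then obtain P \<zeta> where P: "\<And>k. P k \<in> epi ?f" "P \<longlonglongrightarrow> (x, a)"
    and \<zeta>: "\<And>k. \<zeta> k \<in> regular_normal_cone (epi ?f) (P k)" "\<zeta> \<longlonglongrightarrow> (v, -1)"
    unfolding limiting_normal_cone_def by blast
  define \<Phi> where "\<Phi> = (\<lambda>p :: (real^'n) \<times> real. (F (fst p) + u, snd p - f0 (fst p)))"
  define \<Phi>' where "\<Phi>' = (\<lambda>(p :: (real^'n) \<times> real) (h :: (real^'n) \<times> real). (F' (fst p) (fst h), snd h - f0' (fst p) (fst h)))"
  have vim: "epi ?f = \<Phi> -` epi g" by (auto simp: \<Phi>_def composite_le_iff)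
  have der_\<Phi>: "(\<Phi> has_derivative \<Phi>' p) (at p)" for p :: "(real^'n) \<times> real"
  proof -
    have 1: "((\<lambda>p. F (fst p)) has_derivative (\<lambda>h. F' (fst p) (fst h))) (at p)"
      by (rule has_derivative_compose[OF has_derivative_fst[OF has_derivative_ident] der_F])
    have 2: "((\<lambda>p. f0 (fst p)) has_derivative (\<lambda>h. f0' (fst p) (fst h))) (at p)"
      by (rule has_derivative_compose[OF has_derivative_fst[OF has_derivative_ident] der_f0])
    show ?thesis unfolding \<Phi>_def \<Phi>'_def
      by (rule derivative_eq_intros 1 2 refl)+ simp
  qed
  define e where "e = (\<lambda>k. inverse (real (Suc k)))"
  have e: "\<And>k. e k > 0" "e \<longlonglongrightarrow> 0"
    unfolding e_def by (simp, rule LIMSEQ_inverse_real_of_nat)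
  have "\<exists>p q \<eta>. dist p (P k) \<le> e k \<and> q \<in> epi g \<and> dist q (\<Phi> (P k)) \<le> e k \<and>
      (\<forall>w\<in>epi g. \<eta> \<bullet> (w - q) \<le> 0) \<and> (\<forall>h. \<bar>\<eta> \<bullet> \<Phi>' p h - \<zeta> k \<bullet> h\<bar> \<le> e k * norm h)" for k
  proof -
    have "\<Phi> (P k) \<in> epi g" using P(1)[of k] by (simp add: vim)
    from regular_normal_preimage_fuzzy[OF der_\<Phi> convex[unfolded convex_fun_def] closed_epi[OF lsc]
        this \<zeta>(1)[unfolded vim] e(1)]
    show ?thesis by (metis less_imp_le)
  qed
  then obtain Q q \<eta> where Q: "\<And>k. dist (Q k) (P k) \<le> e k"
    and q: "\<And>k. q k \<in> epi g" "\<And>k. dist (q k) (\<Phi> (P k)) \<le> e k"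
    and \<eta>: "\<And>k w. w \<in> epi g \<Longrightarrow> \<eta> k \<bullet> (w - q k) \<le> 0"
    and \<eta>\<zeta>: "\<And>k h. \<bar>\<eta> k \<bullet> \<Phi>' (Q k) h - \<zeta> k \<bullet> h\<bar> \<le> e k * norm h"
    by metis
  \<comment> \<open>Division by \<open>c k\<close> rescales the normal to last component
    \<open>-1\<close>, that of a subgradient.\<close>
  define X Z c Y where defs: "X k = fst (Q k)" "Z k = fst (q k)" "c k = - snd (\<eta> k)"
    "Y k = fst (\<eta> k) /\<^sub>R c k" for k
  have X: "X \<longlonglongrightarrow> x"
    using tendsto_fst[OF LIMSEQ_of_dist_le[OF P(2) Q e(2)]] by (simp add: defs[abs_def])
  have "(\<lambda>k. \<Phi> (P k)) \<longlonglongrightarrow> \<Phi> (x, a)"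
    by (rule isCont_tendsto_compose[OF has_derivative_continuous[OF der_\<Phi>] P(2)])
  from tendsto_fst[OF LIMSEQ_of_dist_le[OF this q(2) e(2)]]
  have Z: "Z \<longlonglongrightarrow> F x + u" by (simp add: defs[abs_def] \<Phi>_def)
  have pair: "(\<lambda>k. \<eta> k \<bullet> \<Phi>' (Q k) h) \<longlonglongrightarrow> (v, -1) \<bullet> h" for h
  proof (rule LIMSEQ_of_dist_le)
    show "(\<lambda>k. \<zeta> k \<bullet> h) \<longlonglongrightarrow> (v, -1) \<bullet> h" by (intro tendsto_intros \<zeta>)
    show "dist (\<eta> k \<bullet> \<Phi>' (Q k) h) (\<zeta> k \<bullet> h) \<le> e k * norm h" for k
      using \<eta>\<zeta>[of k h] by (simp add: dist_real_def)
    show "(\<lambda>k. e k * norm h) \<longlonglongrightarrow> 0" by (intro tendsto_mult_left_zero e)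
  qed
  have zero: "F' x 0 = 0" "f0' x 0 = 0" for x
    using der_F der_f0 by (auto intro!: linear_0 has_derivative_linear)
  \<comment> \<open>The vertical direction isolates the last component of the normal; its limit
    makes \<open>c k\<close> eventually positive.\<close>
  have "(\<lambda>k. - (\<eta> k \<bullet> \<Phi>' (Q k) (0, 1))) \<longlonglongrightarrow> - ((v, -1) \<bullet> (0, 1 :: real))"
    by (intro tendsto_minus pair)
  then have c: "c \<longlonglongrightarrow> 1" by (simp add: \<Phi>'_def zero defs(3)[abs_def] inner_prod_def)
  then have cpos: "\<forall>\<^sub>F k in sequentially. c k > 0" by (rule order_tendstoD) simp
  have "\<forall>\<^sub>F k in sequentially. Y k \<in> limiting_subdiff g (Z k)"
    using cpos
  proof eventually_elim
    case (elim k)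
    have S: "g (Z k) \<le> ereal (snd (q k))" using q(1)[of k] by (cases "q k") (simp add: defs)
    show ?case
      unfolding subdiff_iff
    proof (intro conjI allI impI)
      show "\<bar>g (Z k)\<bar> \<noteq> \<infinity>" using proper S by (rule proper_finite)
      fix w s assume "g w \<le> ereal s"
      then have "\<eta> k \<bullet> ((w, s) - q k) \<le> 0" by (intro \<eta>) simp
      then have "fst (\<eta> k) \<bullet> (w - Z k) \<le> c k * (s - snd (q k))"
        by (simp add: inner_prod_def defs(2,3) algebra_simps)
      then have "snd (q k) \<le> s - Y k \<bullet> (w - Z k)"
        using elim by (simp add: defs(4) field_simps)
      with S show "g (Z k) \<le> ereal (s - Y k \<bullet> (w - Z k))" by (meson ereal_less_eq(3) order_trans)
    qed
  qed
  moreover have "(\<lambda>k. gradL (Y k) (X k)) \<longlonglongrightarrow> v"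
  proof (rule tendsto_componentwise_iff[THEN iffD2], rule ballI)
    fix b :: "real^'n"
    have "(\<lambda>k. (\<eta> k \<bullet> \<Phi>' (Q k) (b, 0)) / c k) \<longlonglongrightarrow> ((v, -1) \<bullet> (b, 0 :: real)) / 1"
      by (intro tendsto_divide pair c) simp
    moreover have "\<forall>\<^sub>F k in sequentially. (\<eta> k \<bullet> \<Phi>' (Q k) (b, 0)) / c k = gradL (Y k) (X k) \<bullet> b"
      using cpos
    proof eventually_elim
      case (elim k)
      have "\<eta> k \<bullet> \<Phi>' (Q k) (b, 0) = c k * f0' (X k) b + fst (\<eta> k) \<bullet> F' (X k) b"
        by (simp add: inner_prod_def \<Phi>'_def defs)
      then show ?case using elim by (simp add: gradL_inner defs(4) field_simps)
    qed
    ultimately show "(\<lambda>k. gradL (Y k) (X k) \<bullet> b) \<longlonglongrightarrow> v \<bullet> b"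
      by (auto intro: Lim_transform_eventually)
  qed
  ultimately show thesis using that X Z by blast
qed

text \<open>Unbounded multipliers would, after normalisation, accumulate at a vector violating the
  qualification condition.\<close>

lemma multipliers_bounded:
  assumes fin: "\<bar>g (F x0)\<bar> \<noteq> \<infinity>"
    and qc: "\<And>y. transpose (jacobian F (at x0)) *v y = 0 \<Longrightarrow> y \<in> singular_subdiff g (F x0) \<Longrightarrow> y = 0"
  obtains \<delta> K where "\<delta> > 0" "K > 0"
    "\<And>x z y. dist x x0 < \<delta> \<Longrightarrow> dist z (F x0) < \<delta> \<Longrightarrow> y \<in> limiting_subdiff g z \<Longrightarrow>
      norm y \<le> K * (1 + norm (gradL y x))"
proof (rule ccontr)
  assume neg: "\<not> thesis"
  \<comment> \<open>The summand \<open>1\<close> in the bound makes \<open>norm (Y k)\<close>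
    unbounded, and the other summand makes the gradients negligible compared with it.\<close>
  have "\<exists>x z y. dist x x0 < inverse (real (Suc k)) \<and> dist z (F x0) < inverse (real (Suc k)) \<and>
      y \<in> limiting_subdiff g z \<and> norm y > real (Suc k) * (1 + norm (gradL y x))" for k
    using neg that[of "inverse (real (Suc k))" "real (Suc k)"] by (force simp: not_le)
  then obtain X Z Y where X: "\<And>k. dist (X k) x0 < inverse (real (Suc k))"
    and Z: "\<And>k. dist (Z k) (F x0) < inverse (real (Suc k))"
    and Y: "\<And>k. Y k \<in> limiting_subdiff g (Z k)"
    and big: "\<And>k. norm (Y k) > real (Suc k) * (1 + norm (gradL (Y k) (X k)))"
    by metis
  have Xlim: "X \<longlonglongrightarrow> x0"
    by (rule LIMSEQ_of_dist_le[OF tendsto_const _ LIMSEQ_inverse_real_of_nat]) (rule less_imp_le[OF X])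
  have Zlim: "Z \<longlonglongrightarrow> F x0"
    by (rule LIMSEQ_of_dist_le[OF tendsto_const _ LIMSEQ_inverse_real_of_nat]) (rule less_imp_le[OF Z])
  define n where "n k = norm (Y k)" for k
  have n: "n k > real (Suc k)" "norm (gradL (Y k) (X k)) / n k < inverse (real (Suc k))" for k
  proof -
    have b: "real (Suc k) + real (Suc k) * norm (gradL (Y k) (X k)) < n k"
      using big[of k] by (simp add: n_def algebra_simps)
    moreover have "0 \<le> real (Suc k) * norm (gradL (Y k) (X k))" by (intro mult_nonneg_nonneg) auto
    ultimately show 1: "n k > real (Suc k)" by linarith
    have "real (Suc k) * norm (gradL (Y k) (X k)) < n k" using b by simp
    then have "norm (gradL (Y k) (X k)) < inverse (real (Suc k)) * n k"
      by (simp add: field_simps del: of_nat_Suc)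
    moreover have "n k > 0" using 1 by (simp add: order_less_trans[of 0 "real (Suc k)"])
    ultimately show "norm (gradL (Y k) (X k)) / n k < inverse (real (Suc k))"
      by (simp add: divide_less_eq)
  qed
  have npos: "n k > 0" for k using n(1)[of k] by linarith
  have ninv: "(\<lambda>k. inverse (n k)) \<longlonglongrightarrow> 0"
  proof (rule tendsto_sandwich[OF _ _ tendsto_const LIMSEQ_inverse_real_of_nat])
    show "\<forall>\<^sub>F k in sequentially. 0 \<le> inverse (n k)" using npos by (simp add: less_imp_le)
    show "\<forall>\<^sub>F k in sequentially. inverse (n k) \<le> inverse (real (Suc k))"
      using n(1) by (intro always_eventually allI le_imp_inverse_le) (auto simp: less_imp_le)
  qed
  define W where "W k = Y k /\<^sub>R n k" for k
  have W1: "norm (W k) = 1" for k using npos[of k] by (simp add: W_def n_def)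
  have "\<forall>\<^sub>F k in sequentially. dist 0 (W k) \<le> 1" by (simp add: W1)
  then obtain w s where s: "strict_mono s" and w: "(\<lambda>k. W (s k)) \<longlonglongrightarrow> w"
    by (rule bounded_seq_convergent_subseq)
  note sub = LIMSEQ_subseq_LIMSEQ[OF _ s, unfolded o_def]
  have w1: "norm w = 1"
    using tendsto_norm[OF w] by (simp add: W1 LIMSEQ_const_iff)
  have grad0: "(\<lambda>k. gradL (Y k) (X k) /\<^sub>R n k) \<longlonglongrightarrow> 0"
  proof (rule LIMSEQ_of_dist_le[OF tendsto_const _ LIMSEQ_inverse_real_of_nat])
    show "dist (gradL (Y k) (X k) /\<^sub>R n k) 0 \<le> inverse (real (Suc k))" for k
      using n(2)[of k] npos[of k] by (simp add: divide_inverse mult.commute)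
  qed
  have "w \<bullet> F' x0 h = 0" for h
  proof (rule LIMSEQ_unique)
    have "(\<lambda>k. W (s k) \<bullet> F' (X (s k)) h) \<longlonglongrightarrow> w \<bullet> F' x0 h"
      by (intro tendsto_intros w F'_tendsto sub[OF Xlim])
    then show "(\<lambda>k. W (s k) \<bullet> F' (X (s k)) h) \<longlonglongrightarrow> w \<bullet> F' x0 h" .
    \<comment> \<open>After division by \<open>n k\<close> the contribution of \<open>f0\<close>
      vanishes and only the Jacobian of \<open>F\<close> remains.\<close>
    have "(\<lambda>k. (gradL (Y k) (X k) /\<^sub>R n k) \<bullet> h - inverse (n k) * f0' (X k) h) \<longlonglongrightarrow> 0 \<bullet> h - 0 * f0' x0 h"
      by (intro tendsto_intros grad0 ninv f0'_tendsto Xlim)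
    moreover have "(gradL (Y k) (X k) /\<^sub>R n k) \<bullet> h - inverse (n k) * f0' (X k) h = W k \<bullet> F' (X k) h" for k
      by (simp add: gradL_inner W_def algebra_simps)
    ultimately show "(\<lambda>k. W (s k) \<bullet> F' (X (s k)) h) \<longlonglongrightarrow> 0"
      using sub[of "\<lambda>k. W k \<bullet> F' (X k) h" 0] by simp
  qed
  then have "transpose (jacobian F (at x0)) *v w = 0"
    by (simp only: transpose_jacobian_eq scaleR_zero_left sum.neutral_const)
  moreover have "w \<in> singular_subdiff g (F x0)"
  proof (rule singular_subdiff_convexI[OF convex fin])
    fix z r assume zr: "g z \<le> ereal r"
    \<comment> \<open>Lower semicontinuity keeps \<open>g (Z k)\<close> above a fixed level, so the
      function values disappear after division by \<open>n k\<close>.\<close>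
    obtain c where "ereal c < g (F x0)"
      using fin by (cases "g (F x0)") (auto intro: that[of "real_of_ereal (g (F x0)) - 1"])
    from filterlim_iff[THEN iffD1, rule_format, OF Zlim lower_semicont_eventually_gt[OF lsc this]]
    have "\<forall>\<^sub>F k in sequentially. ereal c < g (Z k)" .
    then have "\<forall>\<^sub>F k in sequentially. W k \<bullet> (z - Z k) \<le> inverse (n k) * (r - c)"
    proof eventually_elim
      case (elim k)
      have "g (Z k) \<le> ereal (r - Y k \<bullet> (z - Z k))" using Y[of k] zr unfolding subdiff_iff by blast
      with elim have "c < r - Y k \<bullet> (z - Z k)" by (meson less_ereal.simps(1) less_le_trans)
      then have "inverse (n k) * (Y k \<bullet> (z - Z k)) \<le> inverse (n k) * (r - c)"
        using npos[of k] by (intro mult_left_mono) auto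
      then show ?case by (simp add: W_def)
    qed
    then have ev: "\<forall>\<^sub>F k in sequentially. W (s k) \<bullet> (z - Z (s k)) \<le> inverse (n (s k)) * (r - c)"
      using filterlim_iff[THEN iffD1, rule_format, OF filterlim_subseq[OF s]] by blast
    have "w \<bullet> (z - F x0) \<le> 0 * (r - c)"
    proof (rule tendsto_le[OF sequentially_bot _ _ ev])
      show "(\<lambda>k. inverse (n (s k)) * (r - c)) \<longlonglongrightarrow> 0 * (r - c)"
        by (intro tendsto_intros sub[OF ninv])
      show "(\<lambda>k. W (s k) \<bullet> (z - Z (s k))) \<longlonglongrightarrow> w \<bullet> (z - F x0)"
        by (intro tendsto_intros w sub[OF Zlim])
    qed
    then show "w \<bullet> (z - F x0) \<le> 0" by simp
  qed
  ultimately have "w = 0" by (rule qc)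
  then show False using w1 by simp
qed

text \<open>Once \<open>X j\<close> and \<open>F (X j) + U j\<close> lie in the neighbourhood of the
  multiplier bound, so do their approximants for that fixed \<open>j\<close>. The approximate
  multipliers are then bounded, and a cluster point is an exact multiplier by closedness of the
  subdifferential.\<close>

lemma stationary_has_multiplier:
  assumes fin: "\<bar>g (F x0)\<bar> \<noteq> \<infinity>"
    and qc: "\<And>y. transpose (jacobian F (at x0)) *v y = 0 \<Longrightarrow> y \<in> singular_subdiff g (F x0) \<Longrightarrow> y = 0"
    and lim: "X \<longlonglongrightarrow> x0" "U \<longlonglongrightarrow> 0"
    and st: "\<And>k. V k \<in> limiting_subdiff (\<lambda>x. composite f0 F g x (U k)) (X k)"
  shows "\<forall>\<^sub>F k in sequentially. multiplier_map (composite f0 F g) (V k, U k, X k) \<noteq> {}"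
proof -
  obtain \<delta> K where \<delta>: "\<delta> > 0" and K: "K > 0"
    and bound: "\<And>x z y. dist x x0 < \<delta> \<Longrightarrow> dist z (F x0) < \<delta> \<Longrightarrow> y \<in> limiting_subdiff g z \<Longrightarrow>
      norm y \<le> K * (1 + norm (gradL y x))"
    using multipliers_bounded[OF fin qc] by metis
  have "(\<lambda>k. F (X k) + U k) \<longlonglongrightarrow> F x0 + 0" by (intro tendsto_intros F_tendsto lim)
  then have "\<forall>\<^sub>F k in sequentially. dist (F (X k) + U k) (F x0) < \<delta>"
    using tendstoD[OF _ \<delta>] by fastforce
  with tendstoD[OF lim(1) \<delta>] show ?thesis
  proof eventually_elim
    case (elim j)
    obtain X' Z Y where X': "X' \<longlonglongrightarrow> X j" and Z: "Z \<longlonglongrightarrow> F (X j) + U j"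
      and Y: "\<forall>\<^sub>F k in sequentially. Y k \<in> limiting_subdiff g (Z k)"
      and grad: "(\<lambda>k. gradL (Y k) (X' k)) \<longlonglongrightarrow> V j"
      using stationary_fuzzy[OF st[of j]] .
    have e1: "\<forall>\<^sub>F k in sequentially. dist (X' k) x0 < \<delta>"
      by (rule order_tendstoD[OF tendsto_dist[OF X' tendsto_const]]) (rule elim)
    have e2: "\<forall>\<^sub>F k in sequentially. dist (Z k) (F x0) < \<delta>"
      by (rule order_tendstoD[OF tendsto_dist[OF Z tendsto_const]]) (rule elim)
    have e3: "\<forall>\<^sub>F k in sequentially. norm (gradL (Y k) (X' k)) < norm (V j) + 1"
      by (rule order_tendstoD[OF tendsto_norm[OF grad]]) simp
    have "\<forall>\<^sub>F k in sequentially. dist 0 (Y k) \<le> K * (1 + (norm (V j) + 1))"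
      using e1 e2 e3 Y
    proof eventually_elim
      case (elim k)
      have "norm (Y k) \<le> K * (1 + norm (gradL (Y k) (X' k)))" using elim by (intro bound)
      also have "\<dots> \<le> K * (1 + (norm (V j) + 1))" using elim K by (intro mult_left_mono) auto
      finally show ?case by simp
    qed
    then obtain y s where s: "strict_mono s" and y: "(\<lambda>k. Y (s k)) \<longlonglongrightarrow> y"
      by (rule bounded_seq_convergent_subseq)
    note sub = LIMSEQ_subseq_LIMSEQ[OF _ s, unfolded o_def]
    have "\<forall>\<^sub>F k in sequentially. Y (s k) \<in> limiting_subdiff g (Z (s k))"
      using filterlim_iff[THEN iffD1, rule_format, OF filterlim_subseq[OF s] Y] .
    then have "y \<in> limiting_subdiff g (F (X j) + U j)"
      by (rule subdiff_closed[OF sub[OF Z] y])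
    moreover have "gradL y (X j) = V j"
      by (rule LIMSEQ_unique[OF gradL_tendsto[OF sub[OF X'] y] sub[OF grad]])
    ultimately have "y \<in> multiplier_map (composite f0 F g) (V j, U j, X j)"
      by (simp add: multiplier_map_iff)
    then show ?case by blast
  qed
qed

end

section \<open>Isolated calmness and noncriticality\<close>

context smooth_composite
begin

text \<open>Calmness divided by \<open>t k\<close> bounds \<open>norm (d k)\<close> by the scaled
  perturbations, which vanish. Both conclusions drawn from calmness reduce to this.\<close>

lemma isolatedly_calm_tangent:
  assumes calm: "isolatedly_calm (stationary_map (composite f0 F g)) (0, 0) x0"
    and t: "\<And>k. 0 < t k" "t \<longlonglongrightarrow> 0" and d: "d \<longlonglongrightarrow> d0"
    and V: "(\<lambda>k. V k /\<^sub>R t k) \<longlonglongrightarrow> 0" and U: "(\<lambda>k. U k /\<^sub>R t k) \<longlonglongrightarrow> 0"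
    and st: "\<And>k. V k \<in> limiting_subdiff (\<lambda>x. composite f0 F g x (U k)) (x0 + t k *\<^sub>R d k)"
  shows "d0 = 0"
proof -
  obtain \<kappa> W where "\<kappa> > 0" "open W" "x0 \<in> W"
    and calm': "\<And>a x. x \<in> stationary_map (composite f0 F g) a \<Longrightarrow> x \<in> W \<Longrightarrow>
      norm (x - x0) \<le> \<kappa> * norm (a - (0, 0))"
    using calm unfolding isolatedly_calm_def by blast
  have "(\<lambda>k. x0 + t k *\<^sub>R d k) \<longlonglongrightarrow> x0 + 0 *\<^sub>R d0" by (intro tendsto_intros t d)
  then have "\<forall>\<^sub>F k in sequentially. x0 + t k *\<^sub>R d k \<in> W"
    using \<open>open W\<close> \<open>x0 \<in> W\<close> by (auto intro: topological_tendstoD)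
  then have ev: "\<forall>\<^sub>F k in sequentially. norm (d k) \<le> \<kappa> * norm (V k /\<^sub>R t k, U k /\<^sub>R t k)"
  proof eventually_elim
    case (elim k)
    have "t k * norm (d k) \<le> \<kappa> * norm (V k, U k)"
      using calm'[of "x0 + t k *\<^sub>R d k" "(V k, U k)"] st[of k] elim t(1)[of k]
      by (simp add: stationary_map_def)
    also have "(V k, U k) = t k *\<^sub>R (V k /\<^sub>R t k, U k /\<^sub>R t k)" using t(1)[of k] by simp
    also have "norm \<dots> = t k * norm (V k /\<^sub>R t k, U k /\<^sub>R t k)" using t(1)[of k] by (simp only: norm_scaleR)
    finally show ?case using t(1)[of k] by (simp add: mult.left_commute[of \<kappa>])
  qed
  have "norm d0 \<le> \<kappa> * norm (0 :: real^'n, 0 :: real^'m)"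
    by (rule tendsto_le[OF sequentially_bot _ _ ev]) (intro tendsto_intros V U d)+
  then show ?thesis by simp
qed

lemma calm_imp_noncritical:
  assumes calm: "isolatedly_calm (stationary_map (composite f0 F g)) (0, 0) x0"
    and y0: "y0 \<in> multiplier_map (composite f0 F g) (0, 0, x0)"
  shows "noncritical f0 F g x0 y0"
  unfolding noncritical_def
proof (intro allI impI, elim conjE)
  fix dx dy
  assume eq: "hessian (\<lambda>x. lagrangian f0 F x y0) x0 *v dx + transpose (jacobian F (at x0)) *v dy = 0"
    and dy: "dy \<in> graphical_derivative (limiting_subdiff g) (F x0) y0 (jacobian F (at x0) *v dx)"
  have grad0: "gradL y0 x0 = 0" using y0 by (simp add: multiplier_map_iff)
  from dy obtain dk t where dk: "dk \<longlonglongrightarrow> (F' x0 dx, dy)" and t: "\<And>k. 0 < t k" "t \<longlonglongrightarrow> 0"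
    and gph: "\<And>k. (F x0, y0) + t k *\<^sub>R dk k \<in> svm_gph (limiting_subdiff g)"
    unfolding graphical_derivative_def tangent_cone_def jacobian_mult by blast
  define w e where "w k = fst (dk k)" and "e k = snd (dk k)" for k
  have w: "w \<longlonglongrightarrow> F' x0 dx" and e: "e \<longlonglongrightarrow> dy"
    using tendsto_fst[OF dk] tendsto_snd[OF dk] by (simp_all add: w_def[abs_def] e_def[abs_def])
  have sub: "y0 + t k *\<^sub>R e k \<in> limiting_subdiff g (F x0 + t k *\<^sub>R w k)" for k
    using gph[of k] by (simp add: svm_gph_def w_def e_def split_beta)
  \<comment> \<open>This makes \<open>F (x0 + t k *\<^sub>R dx) + U k\<close> the very point where
    \<open>y0 + t k *\<^sub>R e k\<close> is a subgradient. It is of order \<open>o(t)\<close>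
    because \<open>w\<close> tends to \<open>F' x0 dx\<close>.\<close>
  define U where "U k = F x0 + t k *\<^sub>R w k - F (x0 + t k *\<^sub>R dx)" for k
  show "dx = 0"
  proof (rule isolatedly_calm_tangent[OF calm t tendsto_const])
    show "(\<lambda>k. gradL (y0 + t k *\<^sub>R e k) (x0 + t k *\<^sub>R dx) /\<^sub>R t k) \<longlonglongrightarrow> 0"
      using gradL_quotient_tendsto[OF t tendsto_const e, of y0 x0 dx]
      by (simp only: eq grad0 diff_zero)
    have "(\<lambda>k. w k - (F (x0 + t k *\<^sub>R dx) - F x0) /\<^sub>R t k) \<longlonglongrightarrow> F' x0 dx - F' x0 dx"
      by (intro tendsto_intros w has_derivative_quotient_tendsto[OF der_F _ t])
    moreover have "w k - (F (x0 + t k *\<^sub>R dx) - F x0) /\<^sub>R t k = U k /\<^sub>R t k" for k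
      using t(1)[of k] by (simp add: U_def scaleR_diff_right scaleR_add_right)
    ultimately show "(\<lambda>k. U k /\<^sub>R t k) \<longlonglongrightarrow> 0" by simp
    show "gradL (y0 + t k *\<^sub>R e k) (x0 + t k *\<^sub>R dx)
      \<in> limiting_subdiff (\<lambda>x. composite f0 F g x (U k)) (x0 + t k *\<^sub>R dx)" for k
      using sub[of k] by (intro gradL_stationary) (simp add: U_def)
  qed
qed

text \<open>The property holds through the non-tangency alternative of its definition; no
  multipliers are constructed, as none need exist at the reference point.\<close>

lemma calm_imp_inner_calm:
  assumes calm: "isolatedly_calm (stationary_map (composite f0 F g)) (0, 0) x0" and dx: "dx \<noteq> 0"
  shows "inner_calm_star_fuzzy (multiplier_map (composite f0 F g)) (0, 0, x0) (0, 0, dx)"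
proof -
  have "(0, 0, dx) \<notin> tangent_cone (svm_dom (multiplier_map (composite f0 F g))) (0, 0, x0)"
  proof
    assume "(0, 0, dx) \<in> tangent_cone (svm_dom (multiplier_map (composite f0 F g))) (0, 0, x0)"
    then obtain dk t where dk: "dk \<longlonglongrightarrow> (0, 0, dx)" and t: "\<And>k. 0 < t k" "t \<longlonglongrightarrow> 0"
      and dom: "\<And>k. (0, 0, x0) + t k *\<^sub>R dk k \<in> svm_dom (multiplier_map (composite f0 F g))"
      unfolding tangent_cone_def by blast
    define v u d where defs: "v k = fst (dk k)" "u k = fst (snd (dk k))" "d k = snd (snd (dk k))" for k
    have lims: "v \<longlonglongrightarrow> 0" "u \<longlonglongrightarrow> 0" "d \<longlonglongrightarrow> dx"
      using tendsto_fst[OF dk] tendsto_fst[OF tendsto_snd[OF dk]] tendsto_snd[OF tendsto_snd[OF dk]]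
      by (simp_all add: defs[abs_def])
    have "(0, 0, x0) + t k *\<^sub>R dk k = (t k *\<^sub>R v k, t k *\<^sub>R u k, x0 + t k *\<^sub>R d k)" for k
      by (cases "dk k") (simp add: defs)
    with dom have "\<exists>y. y \<in> multiplier_map (composite f0 F g) (t k *\<^sub>R v k, t k *\<^sub>R u k, x0 + t k *\<^sub>R d k)" for k
      by (simp add: svm_dom_def ex_in_conv)
    then have st: "t k *\<^sub>R v k \<in> limiting_subdiff (\<lambda>x. composite f0 F g x (t k *\<^sub>R u k)) (x0 + t k *\<^sub>R d k)" for k
      unfolding multiplier_map_iff by (metis gradL_stationary)
    have "(t k *\<^sub>R v k) /\<^sub>R t k = v k" "(t k *\<^sub>R u k) /\<^sub>R t k = u k" for k
      using t(1)[of k] by simp_all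
    then have "dx = 0"
      using lims by (intro isolatedly_calm_tangent[OF calm t lims(3) _ _ st]) simp_all
    then show False using dx by blast
  qed
  then show ?thesis by (simp add: inner_calm_star_fuzzy_def)
qed

text \<open>The estimate of inner calmness* refers to one fixed \<open>y0\<close>, so the quotients
  of \<open>Y k - y0\<close> by \<open>t k\<close> are bounded, and a cluster point
  \<open>e0\<close> of them is the candidate for \<open>dy\<close> in the definition of
  noncriticality.\<close>

lemma noncritical_inner_calm_imp_zero:
  assumes nc: "\<And>y. y \<in> multiplier_map (composite f0 F g) (0, 0, x0) \<Longrightarrow> noncritical f0 F g x0 y"
    and ic: "inner_calm_star_fuzzy (multiplier_map (composite f0 F g)) (0, 0, x0) (0, 0, dx)"
    and tan: "(0, 0, dx) \<in> tangent_cone (svm_dom (multiplier_map (composite f0 F g))) (0, 0, x0)"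
  shows "dx = 0"
proof -
  from ic tan obtain \<kappa> y0 dk t Y where dk: "dk \<longlonglongrightarrow> (0, 0, dx)" and t: "\<And>k. 0 < t k" "t \<longlonglongrightarrow> 0"
    and "Y \<longlonglongrightarrow> y0"
    and Y: "\<And>k. Y k \<in> multiplier_map (composite f0 F g) ((0, 0, x0) + t k *\<^sub>R dk k)"
    and bnd: "\<And>k. norm (Y k - y0) \<le> \<kappa> * t k * norm (dk k)" and \<kappa>: "\<kappa> > 0"
    unfolding inner_calm_star_fuzzy_def by blast
  define e where "e k = (Y k - y0) /\<^sub>R t k" for k
  have Ye: "Y k = y0 + t k *\<^sub>R e k" for k using t(1)[of k] by (simp add: e_def)
  have "\<forall>\<^sub>F k in sequentially. norm (dk k) < norm (0 :: real^'n, 0 :: real^'m, dx) + 1"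
    by (rule order_tendstoD[OF tendsto_norm[OF dk]]) simp
  then have "\<forall>\<^sub>F k in sequentially. dist 0 (e k) \<le> \<kappa> * (norm (0 :: real^'n, 0 :: real^'m, dx) + 1)"
  proof eventually_elim
    case (elim k)
    have "norm (e k) \<le> \<kappa> * norm (dk k)"
    proof -
      have "norm (e k) = norm (Y k - y0) / t k" using t(1)[of k] by (simp add: e_def divide_inverse mult.commute)
      also have "\<dots> \<le> \<kappa> * norm (dk k)"
        using bnd[of k] t(1)[of k] by (simp add: divide_le_eq ac_simps)
      finally show ?thesis .
    qed
    also have "\<dots> \<le> \<kappa> * (norm (0 :: real^'n, 0 :: real^'m, dx) + 1)"
      using elim \<kappa> by (intro mult_left_mono) auto
    finally show ?case by simp
  qed
  then obtain e0 s where s: "strict_mono s" and e: "(\<lambda>k. e (s k)) \<longlonglongrightarrow> e0"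
    by (rule bounded_seq_convergent_subseq)
  note sub = LIMSEQ_subseq_LIMSEQ[OF _ s, unfolded o_def]
  define v u d where defs: "v k = fst (dk (s k))" "u k = fst (snd (dk (s k)))" "d k = snd (snd (dk (s k)))" for k
  have lims: "v \<longlonglongrightarrow> 0" "u \<longlonglongrightarrow> 0" "d \<longlonglongrightarrow> dx"
    using tendsto_fst[OF sub[OF dk]] tendsto_fst[OF tendsto_snd[OF sub[OF dk]]]
      tendsto_snd[OF tendsto_snd[OF sub[OF dk]]]
    by (simp_all add: defs[abs_def])
  define \<tau> where "\<tau> k = t (s k)" for k
  have \<tau>: "\<And>k. \<tau> k > 0" "\<tau> \<longlonglongrightarrow> 0" using t(1) sub[OF t(2)] by (simp_all add: \<tau>_def[abs_def])
  have "(0, 0, x0) + \<tau> k *\<^sub>R dk (s k) = (\<tau> k *\<^sub>R v k, \<tau> k *\<^sub>R u k, x0 + \<tau> k *\<^sub>R d k)" for k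
    by (cases "dk (s k)") (simp add: defs)
  with Y[of "s k" for k] have mult: "gradL (y0 + \<tau> k *\<^sub>R e (s k)) (x0 + \<tau> k *\<^sub>R d k) = \<tau> k *\<^sub>R v k"
    "y0 + \<tau> k *\<^sub>R e (s k) \<in> limiting_subdiff g (F (x0 + \<tau> k *\<^sub>R d k) + \<tau> k *\<^sub>R u k)" for k
    by (simp_all add: \<tau>_def[symmetric] Ye multiplier_map_iff)
  have "(\<lambda>k. x0 + \<tau> k *\<^sub>R d k) \<longlonglongrightarrow> x0 + 0 *\<^sub>R dx" "(\<lambda>k. y0 + \<tau> k *\<^sub>R e (s k)) \<longlonglongrightarrow> y0 + 0 *\<^sub>R e0"
    by (intro tendsto_intros \<tau> lims e)+
  then have Xlim: "(\<lambda>k. x0 + \<tau> k *\<^sub>R d k) \<longlonglongrightarrow> x0" and Ylim: "(\<lambda>k. y0 + \<tau> k *\<^sub>R e (s k)) \<longlonglongrightarrow> y0"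
    by simp_all
  have "(\<lambda>k. F (x0 + \<tau> k *\<^sub>R d k) + \<tau> k *\<^sub>R u k) \<longlonglongrightarrow> F x0 + 0 *\<^sub>R 0"
    by (intro tendsto_intros F_tendsto Xlim \<tau> lims)
  then have "(\<lambda>k. F (x0 + \<tau> k *\<^sub>R d k) + \<tau> k *\<^sub>R u k) \<longlonglongrightarrow> F x0" by simp
  \<comment> \<open>Inner calmness* does not state that \<open>y0\<close> is a multiplier at the
    reference point; closedness of the subdifferential and continuity of the gradient provide this,
    so that \<open>nc\<close> applies.\<close>
  then have y0: "y0 \<in> limiting_subdiff g (F x0)"
    by (rule subdiff_closed[OF _ Ylim]) (simp add: mult)
  have "(\<lambda>k. \<tau> k *\<^sub>R v k) \<longlonglongrightarrow> 0 *\<^sub>R 0" by (intro tendsto_intros \<tau> lims)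
  then have grad0: "gradL y0 x0 = 0"
    using gradL_tendsto[OF Xlim Ylim] by (intro LIMSEQ_unique) (auto simp: mult(1))
  have "noncritical f0 F g x0 y0" using y0 grad0 by (intro nc) (simp add: multiplier_map_iff)
  moreover have "hessian (\<lambda>x. lagrangian f0 F x y0) x0 *v dx + transpose (jacobian F (at x0)) *v e0 = 0"
  proof (rule LIMSEQ_unique[OF gradL_quotient_tendsto[OF \<tau> lims(3) e]])
    have "(gradL (y0 + \<tau> k *\<^sub>R e (s k)) (x0 + \<tau> k *\<^sub>R d k) - gradL y0 x0) /\<^sub>R \<tau> k = v k" for k
      using \<tau>(1)[of k] by (simp add: mult(1) grad0)
    then show "(\<lambda>k. (gradL (y0 + \<tau> k *\<^sub>R e (s k)) (x0 + \<tau> k *\<^sub>R d k) - gradL y0 x0) /\<^sub>R \<tau> k) \<longlonglongrightarrow> 0"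
      using lims(1) by simp
  qed
  moreover have "e0 \<in> graphical_derivative (limiting_subdiff g) (F x0) y0 (jacobian F (at x0) *v dx)"
    unfolding graphical_derivative_def mem_Collect_eq jacobian_mult
  proof (rule tangent_coneI[OF _ \<tau>])
    \<comment> \<open>Adding \<open>u k\<close> to the quotient reproduces the perturbed argument of
      \<open>g\<close> exactly; as \<open>u\<close> vanishes, the limit direction is
      unaffected.\<close>
    show "(\<lambda>k. ((F (x0 + \<tau> k *\<^sub>R d k) - F x0) /\<^sub>R \<tau> k + u k, e (s k))) \<longlonglongrightarrow> (F' x0 dx, e0)"
    proof (rule tendsto_Pair[OF _ e])
      have "(\<lambda>k. (F (x0 + \<tau> k *\<^sub>R d k) - F x0) /\<^sub>R \<tau> k + u k) \<longlonglongrightarrow> F' x0 dx + 0"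
        by (intro tendsto_add lims has_derivative_quotient_tendsto[OF der_F _ \<tau>])
      then show "(\<lambda>k. (F (x0 + \<tau> k *\<^sub>R d k) - F x0) /\<^sub>R \<tau> k + u k) \<longlonglongrightarrow> F' x0 dx" by simp
    qed
    show "(F x0, y0) + \<tau> k *\<^sub>R ((F (x0 + \<tau> k *\<^sub>R d k) - F x0) /\<^sub>R \<tau> k + u k, e (s k))
        \<in> svm_gph (limiting_subdiff g)" for k
      using mult(2)[of k] \<tau>(1)[of k] by (simp add: svm_gph_def scaleR_add_right)
  qed
  ultimately show "dx = 0" unfolding noncritical_def by blast
qed

lemma noncritical_inner_calm_imp_calm:
  assumes st0: "0 \<in> limiting_subdiff (\<lambda>x. composite f0 F g x 0) x0"
    and qc: "\<And>y. transpose (jacobian F (at x0)) *v y = 0 \<Longrightarrow> y \<in> singular_subdiff g (F x0) \<Longrightarrow> y = 0"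
    and nc: "\<And>y. y \<in> multiplier_map (composite f0 F g) (0, 0, x0) \<Longrightarrow> noncritical f0 F g x0 y"
    and ic: "\<And>dx. dx \<noteq> 0 \<Longrightarrow> inner_calm_star_fuzzy (multiplier_map (composite f0 F g)) (0, 0, x0) (0, 0, dx)"
  shows "isolatedly_calm (stationary_map (composite f0 F g)) (0, 0) x0"
proof (rule ccontr)
  let ?M = "stationary_map (composite f0 F g)"
  assume neg: "\<not> isolatedly_calm ?M (0, 0) x0"
  have "\<bar>composite f0 F g x0 0\<bar> \<noteq> \<infinity>" 
    using st0 unfolding limiting_subdiff_def mem_Collect_eq by (rule conjunct1)
  then have fin: "\<bar>g (F x0)\<bar> \<noteq> \<infinity>" unfolding composite_finite_iff by simp
  have "((0, 0), x0) \<in> svm_gph ?M" using st0 by (simp add: svm_gph_def stationary_map_def)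
  with neg have neg': "\<exists>a x. x \<in> ?M a \<and> x \<in> W \<and> \<not> norm (x - x0) \<le> \<kappa> * norm (a - (0, 0))"
    if "\<kappa> > 0" "open W" "x0 \<in> W" for \<kappa> W
    using that unfolding isolatedly_calm_def by blast
  \<comment> \<open>Calmness fails with constant \<open>k + 1\<close> on the ball of radius
    \<open>1 / (k + 1)\<close>, so the perturbations become negligible compared with the distance to
    \<open>x0\<close>.\<close>
  have "\<exists>v u x. x \<in> ?M (v, u) \<and> dist x0 x < inverse (real (Suc k)) \<and>
      real (Suc k) * norm (v, u) < norm (x - x0)" for k
    using neg'[of "real (Suc k)" "ball x0 (inverse (real (Suc k)))"]
    by (simp add: not_le split_paired_Ex)
  then obtain V U X where M: "\<And>k. X k \<in> ?M (V k, U k)"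
    and X: "\<And>k. dist x0 (X k) < inverse (real (Suc k))"
    and big: "\<And>k. real (Suc k) * norm (V k, U k) < norm (X k - x0)"
    by metis
  \<comment> \<open>Scaling by the distance gives unit directions, whose limit cannot vanish.
    Strictness in \<open>big\<close> excludes \<open>X k = x0\<close>.\<close>
  define t where "t k = norm (X k - x0)" for k
  have t: "t k > 0" for k
  proof -
    have "0 \<le> real (Suc k) * norm (V k, U k)" by (intro mult_nonneg_nonneg) auto
    then show ?thesis using big[of k] unfolding t_def by linarith
  qed
  have Xlim: "X \<longlonglongrightarrow> x0"
    by (rule LIMSEQ_of_dist_le[OF tendsto_const _ LIMSEQ_inverse_real_of_nat])
      (metis X dist_commute less_imp_le)
  have tlim: "t \<longlonglongrightarrow> 0"
    using tendsto_norm[OF tendsto_diff[OF Xlim tendsto_const[of x0]]] by (simp add: t_def[abs_def])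
  have small: "norm (V k /\<^sub>R t k, U k /\<^sub>R t k) \<le> inverse (real (Suc k))" for k
  proof -
    have "(V k /\<^sub>R t k, U k /\<^sub>R t k) = (V k, U k) /\<^sub>R t k" by simp
    then have "norm (V k /\<^sub>R t k, U k /\<^sub>R t k) = norm (V k, U k) / t k"
      using t[of k] by (simp only: norm_scaleR) (simp add: divide_inverse mult.commute)
    also have "\<dots> \<le> inverse (real (Suc k))"
      using big[of k] t[of k] by (simp add: t_def field_simps del: of_nat_Suc)
    finally show ?thesis .
  qed
  have "(\<lambda>k. (V k /\<^sub>R t k, U k /\<^sub>R t k)) \<longlonglongrightarrow> (0, 0)"
    by (rule LIMSEQ_of_dist_le[OF tendsto_const _ LIMSEQ_inverse_real_of_nat])
      (use small in \<open>simp add: dist_norm\<close>)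
  note VU = tendsto_fst[OF this, simplified] tendsto_snd[OF this, simplified]
  have "(\<lambda>k. t k *\<^sub>R (U k /\<^sub>R t k)) \<longlonglongrightarrow> 0 *\<^sub>R 0" by (intro tendsto_intros tlim VU)
  moreover have "t k *\<^sub>R (U k /\<^sub>R t k) = U k" for k using t[of k] by simp
  ultimately have Ulim: "U \<longlonglongrightarrow> 0" by simp
  have st: "V k \<in> limiting_subdiff (\<lambda>x. composite f0 F g x (U k)) (X k)" for k
    using M[of k] by (simp add: stationary_map_def)
  obtain N where N: "\<And>k. N \<le> k \<Longrightarrow> multiplier_map (composite f0 F g) (V k, U k, X k) \<noteq> {}"
    using stationary_has_multiplier[OF fin qc Xlim Ulim st] unfolding eventually_sequentially by blast
  define d where "d k = (X k - x0) /\<^sub>R t k" for k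
  have d1: "norm (d k) = 1" for k using t[of k] by (simp add: d_def t_def)
  \<comment> \<open>The shift by \<open>N\<close> is kept because the tangent cone asks for
    membership at every index.\<close>
  have "\<forall>\<^sub>F k in sequentially. dist 0 (d (k + N)) \<le> 1" by (simp add: d1)
  then obtain dx s where s: "strict_mono s" and d: "(\<lambda>k. d (s k + N)) \<longlonglongrightarrow> dx"
    by (rule bounded_seq_convergent_subseq)
  have "strict_mono (\<lambda>k. s k + N)" using s by (simp add: strict_mono_def)
  note sub = LIMSEQ_subseq_LIMSEQ[OF _ this, unfolded o_def]
  have "norm dx = 1" using tendsto_norm[OF d] by (simp add: d1 LIMSEQ_const_iff)
  then have "dx \<noteq> 0" by auto
  have "(0, 0, dx) \<in> tangent_cone (svm_dom (multiplier_map (composite f0 F g))) (0, 0, x0)"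
  proof (rule tangent_coneI)
    let ?n = "\<lambda>k. s k + N"
    show "(\<lambda>k. (V (?n k) /\<^sub>R t (?n k), U (?n k) /\<^sub>R t (?n k), d (?n k))) \<longlonglongrightarrow> (0, 0, dx)"
      by (intro tendsto_Pair d sub[OF VU(1)] sub[OF VU(2)])
    show "0 < t (?n k)" for k by (rule t)
    show "(\<lambda>k. t (?n k)) \<longlonglongrightarrow> 0" by (rule sub[OF tlim])
    show "(0, 0, x0) + t (?n k) *\<^sub>R (V (?n k) /\<^sub>R t (?n k), U (?n k) /\<^sub>R t (?n k), d (?n k))
        \<in> svm_dom (multiplier_map (composite f0 F g))" for k
      using N[of "?n k"] t[of "?n k"] by (simp add: svm_dom_def d_def)
  qed
  with ic[OF \<open>dx \<noteq> 0\<close>] have "dx = 0" by (intro noncritical_inner_calm_imp_zero[OF nc])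
  then show False using \<open>dx \<noteq> 0\<close> by blast
qed

end

text \<open>Evaluation of a bounded linear map at a fixed \<open>b\<close> is itself bounded linear,
  so differentiability of the operator-valued derivative passes to each direction.\<close>

lemma twice_cont_differentiable_obtain:
  assumes "twice_cont_differentiable h"
  obtains h' where "\<And>x. (h has_derivative h' x) (at x)"
    "\<And>x b. (\<lambda>x. h' x b) differentiable (at x)"
proof -
  obtain D D2 where D: "\<And>x. (h has_derivative blinfun_apply (D x)) (at x)"
    and D2: "\<And>x. (D has_derivative blinfun_apply (D2 x)) (at x)"
    using assms unfolding twice_cont_differentiable_def by blast
  have "(\<lambda>x. blinfun_apply (D x) b) differentiable (at x)" for x b
    using bounded_linear.has_derivative[OF blinfun.bounded_linear_left D2] by (rule differentiableI)
  then show thesis using that[of "\<lambda>x. blinfun_apply (D x)"] D by blast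
qed

theorem corollary4p3:
  fixes f0 :: "real^'n \<Rightarrow> real"
    and F :: "real^'n \<Rightarrow> real^'m"
    and g :: "real^'m \<Rightarrow> ereal"
    and f :: "real^'n \<Rightarrow> real^'m \<Rightarrow> ereal"
    and xbar :: "real^'n"
    and stat_a stat_b :: bool
  assumes "twice_cont_differentiable f0"
    and "twice_cont_differentiable F"
    and "proper g" and "lower_semicont g" and "convex_fun g"
    and f: "f = composite f0 F g"
    and "0 \<in> limiting_subdiff (\<lambda>x. f x 0) xbar"
    and a: "stat_a \<longleftrightarrow> isolatedly_calm (stationary_map f) (0, 0) xbar"
    and b: "stat_b \<longleftrightarrow>
        (\<forall>ybar \<in> multiplier_map f (0, 0, xbar). noncritical f0 F g xbar ybar) \<and>
        (\<forall>dx. dx \<noteq> 0 \<longrightarrow> inner_calm_star_fuzzy (multiplier_map f) (0, 0, xbar) (0, 0, dx))"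
  shows "(stat_a \<longrightarrow> stat_b) \<and>
    ((\<forall>y. transpose (jacobian F (at xbar)) *v y = 0 \<and> y \<in> singular_subdiff g (F xbar) \<longrightarrow> y = 0)
      \<longrightarrow> stat_b \<longrightarrow> stat_a)"
proof -
  obtain f0' where f0': "\<And>x. (f0 has_derivative f0' x) (at x)" "\<And>x b. (\<lambda>x. f0' x b) differentiable (at x)"
    using twice_cont_differentiable_obtain[OF assms(1)] by blast
  obtain F' where F': "\<And>x. (F has_derivative F' x) (at x)" "\<And>x b. (\<lambda>x. F' x b) differentiable (at x)"
    using twice_cont_differentiable_obtain[OF assms(2)] by blast
  interpret smooth_composite f0 F g f0' F'
    by (unfold_locales; fact f0' F' assms(3-5))
  have "0 \<in> limiting_subdiff (\<lambda>x. composite f0 F g x 0) xbar" using assms(7) by (simp only: f)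
  note main = noncritical_inner_calm_imp_calm[OF this]
  show ?thesis
    unfolding a b f using calm_imp_noncritical calm_imp_inner_calm main by blast
qed

end
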